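(* Let $k,l,m$ be integers with $2\le k<l<m$. Then \[ r(k,l,m)=\begin{cases} k+2m-2 & \text{if } 3\le k<l<m\le l+\frac{k-1}{2},\\ 2k+2l-3 & \text{if } 3\le k<l \text{ and } l+\frac{k-1}{2}<m<k+l-1,\\ k+l+m-2 & \text{if } 2\le k<l \text{ and } m\ge k+l-1. \end{cases} \]
   Context: For a graph whose edges are coloured with red, blue and green, a red (resp. blue, green) $t$-connected matching is a connected component of the spanning subgraph formed by the red (resp. blue, green) edges whose maximum matching has size at least $t$. For positive integers $k,l,m$, $r(k,l,m)$ denotes the smallest integer $n$ such that every red-blue-green colouring of the edges of the complete bipartite graph $K_{n,n}$ contains a red $k$-connected matching, or a blue $l$-connected matching, or a green $m$-connected matching. *)

theory Defs
  imports Complex_Main "HOL-Library.Disjoint_Sets"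
begin

(* A finite simple graph is given by a vertex set V and a set E of two-element subsets of V. *)

definition adjacency :: "'a set set \<Rightarrow> ('a \<times> 'a) set" where
  "adjacency E = {(u, v). {u, v} \<in> E}"

(* Vertex sets of the components; an isolated vertex is a component of its own. *)
definition graph_components :: "'a set \<Rightarrow> 'a set set \<Rightarrow> 'a set set" where
  "graph_components V E = V // {(u, v). u \<in> V \<and> v \<in> V \<and> (u, v) \<in> (adjacency E)\<^sup>*}"

definition induced_edges :: "'a set set \<Rightarrow> 'a set \<Rightarrow> 'a set set" where
  "induced_edges E C = {e \<in> E. e \<subseteq> C}"

definition matching :: "'a set set \<Rightarrow> 'a set set \<Rightarrow> bool" where
  "matching E M \<longleftrightarrow> M \<subseteq> E \<and> disjoint M"

(* Meaningful for finite E only, since Max is taken over the sizes of all matchings. *)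
definition matching_number :: "'a set set \<Rightarrow> nat" where
  "matching_number E = Max {card M |M. matching E M}"

datatype colour = Red | Blue | Green

(* The two sides of the complete bipartite graph on n + n vertices are the copies of
   {0, ..., n - 1} under Inl and Inr. *)
definition Knn_verts :: "nat \<Rightarrow> (nat + nat) set" where
  "Knn_verts n = {..<n} <+> {..<n}"

definition Knn_edges :: "nat \<Rightarrow> (nat + nat) set set" where
  "Knn_edges n = {{Inl i, Inr j} |i j. i < n \<and> j < n}"

(* A colouring is a function on all sets of vertices, but only its values on the
   edges of the graph are used. *)
definition colour_class :: "nat \<Rightarrow> ((nat + nat) set \<Rightarrow> colour) \<Rightarrow> colour \<Rightarrow> (nat + nat) set set" where
  "colour_class n c x = {e \<in> Knn_edges n. c e = x}"

definition has_connected_matching ::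
    "nat \<Rightarrow> ((nat + nat) set \<Rightarrow> colour) \<Rightarrow> colour \<Rightarrow> nat \<Rightarrow> bool" where
  "has_connected_matching n c x t \<longleftrightarrow>
     (\<exists>C \<in> graph_components (Knn_verts n) (colour_class n c x).
        matching_number (induced_edges (colour_class n c x) C) \<ge> t)"

definition forces_connected_matching :: "nat \<Rightarrow> nat \<Rightarrow> nat \<Rightarrow> nat \<Rightarrow> bool" where
  "forces_connected_matching k l m n \<longleftrightarrow>
     (\<forall>c :: (nat + nat) set \<Rightarrow> colour.
        has_connected_matching n c Red k \<or>
        has_connected_matching n c Blue l \<or>
        has_connected_matching n c Green m)"

definition connected_ramsey :: "nat \<Rightarrow> nat \<Rightarrow> nat \<Rightarrow> nat" where
  "connected_ramsey k l m = (LEAST n. forces_connected_matching k l m n)"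

end

theory Submission
  imports Defs
begin

text \<open>Upper bound. Suppose a colouring of \<open>K\<^bsub>n,n\<^esub>\<close> has no red (blue, green) component with a
  matching of size larger than \<open>s\<close> (\<open>t\<close>, \<open>u\<close>), and \<open>n > s + t + u\<close>. By Koenig's theorem every
  component has a cover of size at most \<open>s\<close> (\<open>t\<close>, \<open>u\<close>); take these covers minimal. Selecting \<open>k\<close>
  components of each colour, with repetition, and weighting the vertices by how often they are
  covered, the total weight is less than \<open>k n\<close>, so for any split of \<open>k\<close> into \<open>p + q\<close> some vertex
  has weight less than \<open>p\<close> on the left or less than \<open>q\<close> on the right. For \<open>k = 1\<close> this shows that
  every vertex is covered in some colour. Playing such light vertices against the minimality of the
  covers rules out all configurations of vertices that are covered in exactly one colour, except
  that on one side such vertices lie in two components of a first colour and on the other side in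
  two components of a second one. There each side is covered by few components, which gives
  \<open>n \<le> s + 2 u\<close> and \<open>n \<le> 2 s + 2 t\<close>.

  Lower bound. Colourings by blocks show that \<open>max (s + t + u) (min (s + 2 u) (2 s + 2 t))\<close> is
  attained.\<close>

section \<open>Labelled covers of three colours\<close>

text \<open>The configuration that survives cannot be refuted, because the block colouring realises
  it: its two left blocks of size \<open>s\<close> are covered in red only, in two components, and
  its last two right blocks in green only, in two components. So everything except this shape has to
  be excluded. Once components are replaced by labels, a refutation names finitely many vertices and
  uses only which of them are covered and which labels coincide. It is then a ground problem about
  equalities, and sizes enter it only through the existence of light vertices. No order of
  \<open>s\<close>, \<open>t\<close>, \<open>u\<close> is assumed until the end, where it eliminates
  two of three symmetric bounds.\<close>

definition weight :: "bool \<Rightarrow> 'l list \<Rightarrow> 'l \<Rightarrow> nat" where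
  "weight b xs x = (if b then count_list xs x else 0)"

lemma one_le_weight: "1 \<le> weight b xs x \<longleftrightarrow> b \<and> x \<in> set xs"
  by (auto simp: weight_def Suc_le_eq count_list_0_iff neq0_conv[symmetric] simp del: neq0_conv)

lemma two_le_weight_3:
  "2 \<le> weight b [i, j, k] x \<longleftrightarrow> b \<and> (x = i \<and> x = j \<or> x = i \<and> x = k \<or> x = j \<and> x = k)"
  by (auto simp: weight_def)

lemma two_le_weight_4:
  "2 \<le> weight b [i, j, k, l] x \<longleftrightarrow> b \<and> (x = i \<and> (x = j \<or> x = k \<or> x = l)
    \<or> x = j \<and> (x = k \<or> x = l) \<or> x = k \<and> x = l)"
  by (auto simp: weight_def)

lemma three_le_weight_4:
  "3 \<le> weight b [i, j, k, l] x \<longleftrightarrow> b \<and> (x = i \<and> x = j \<and> (x = k \<or> x = l)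
    \<or> x = k \<and> x = l \<and> (x = i \<or> x = j))"
  by (auto simp: weight_def)

lemma sum_weight_le:
  assumes "finite V" and cap: "\<And>i. card {v \<in> V. X v \<and> x v = i} \<le> t"
  shows "(\<Sum>v\<in>V. weight (X v) xs (x v)) \<le> length xs * t"
proof (induction xs)
  case Nil
  then show ?case by (simp add: weight_def cong: if_cong)
next
  case (Cons i xs)
  have "(\<Sum>v\<in>V. weight (X v) (i # xs) (x v))
      = (\<Sum>v\<in>V. of_bool (X v \<and> x v = i) + weight (X v) xs (x v))"
    by (rule sum.cong) (auto simp: weight_def)
  also have "\<dots> = card {v \<in> V. X v \<and> x v = i} + (\<Sum>v\<in>V. weight (X v) xs (x v))"
    using \<open>finite V\<close> by (simp add: sum.distrib Int_def)
  also have "\<dots> \<le> t + length xs * t"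
    using cap Cons.IH by (intro add_mono)
  finally show ?case by simp
qed

text \<open>All vertices are covered in some colour (lemma \<open>coloured\<close> below), so that \<open>\<not> D v \<and> \<not> E v\<close> says
  that \<open>v\<close> is covered in the first colour only. The predicates are parametrised by the colours,
    since
  they are used under permutations of these.\<close>

definition alike_singles ::
    "('v \<Rightarrow> 'l) \<Rightarrow> ('v \<Rightarrow> 'l) \<Rightarrow> ('v \<Rightarrow> 'l) \<Rightarrow> ('v \<Rightarrow> bool) \<Rightarrow> ('v \<Rightarrow> bool) \<Rightarrow> ('v \<Rightarrow> bool) \<Rightarrow> 'v \<Rightarrow> 'v \<Rightarrow> bool"
      where
  "alike_singles c d e C D E v w \<longleftrightarrow> (\<not> D v \<and> \<not> E v \<and> \<not> D w \<and> \<not> E w \<longrightarrow> c v = c w)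
    \<and> (\<not> C v \<and> \<not> E v \<and> \<not> C w \<and> \<not> E w \<longrightarrow> d v = d w)
    \<and> (\<not> C v \<and> \<not> D v \<and> \<not> C w \<and> \<not> D w \<longrightarrow> e v = e w)"

text \<open>Two vertices covered in one colour each, but in different colours, are compared in the
  third colour, which covers neither. Both orders of the colours are listed because each pair of
  vertices is instantiated only once. \<open>monochrome_singles\<close> forbids the same pairs
  outright.\<close>

definition misaligned_singles ::
    "('v \<Rightarrow> 'l) \<Rightarrow> ('v \<Rightarrow> 'l) \<Rightarrow> ('v \<Rightarrow> 'l) \<Rightarrow> ('v \<Rightarrow> bool) \<Rightarrow> ('v \<Rightarrow> bool) \<Rightarrow> ('v \<Rightarrow> bool) \<Rightarrow> 'v \<Rightarrow> 'v \<Rightarrow> bool"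
      where
  "misaligned_singles c d e C D E v w \<longleftrightarrow>
    (\<not> D v \<and> \<not> E v \<and> \<not> C w \<and> \<not> D w \<or> \<not> C v \<and> \<not> D v \<and> \<not> D w \<and> \<not> E w \<longrightarrow> d v \<noteq> d w)
    \<and> (\<not> D v \<and> \<not> E v \<and> \<not> C w \<and> \<not> E w \<or> \<not> C v \<and> \<not> E v \<and> \<not> D w \<and> \<not> E w \<longrightarrow> e v \<noteq> e w)
    \<and> (\<not> C v \<and> \<not> E v \<and> \<not> C w \<and> \<not> D w \<or> \<not> C v \<and> \<not> D v \<and> \<not> C w \<and> \<not> E w \<longrightarrow> c v \<noteq> c w)"

definition monochrome_singles ::
    "('v \<Rightarrow> bool) \<Rightarrow> ('v \<Rightarrow> bool) \<Rightarrow> ('v \<Rightarrow> bool) \<Rightarrow> 'v \<Rightarrow> 'v \<Rightarrow> bool" where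
  "monochrome_singles C D E v w \<longleftrightarrow>
    \<not> (\<not> D v \<and> \<not> E v \<and> \<not> C w \<and> \<not> D w \<or> \<not> C v \<and> \<not> D v \<and> \<not> D w \<and> \<not> E w)
    \<and> \<not> (\<not> D v \<and> \<not> E v \<and> \<not> C w \<and> \<not> E w \<or> \<not> C v \<and> \<not> E v \<and> \<not> D w \<and> \<not> E w)
    \<and> \<not> (\<not> C v \<and> \<not> E v \<and> \<not> C w \<and> \<not> D w \<or> \<not> C v \<and> \<not> D v \<and> \<not> C w \<and> \<not> E w)"

definition spread_singles ::
    "('v \<Rightarrow> 'l) \<Rightarrow> ('v \<Rightarrow> 'l) \<Rightarrow> ('v \<Rightarrow> 'l) \<Rightarrow> ('v \<Rightarrow> bool) \<Rightarrow> ('v \<Rightarrow> bool) \<Rightarrow> ('v \<Rightarrow> bool) \<Rightarrow> 'v \<Rightarrow> 'v \<Rightarrow> bool"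
      where
  "spread_singles c d e C D E v w \<longleftrightarrow>
    (\<not> D v \<and> \<not> E v \<and> \<not> D w \<and> \<not> E w \<and> c v \<noteq> c w \<longrightarrow> d v \<noteq> d w \<and> e v \<noteq> e w)
    \<and> (\<not> C v \<and> \<not> E v \<and> \<not> C w \<and> \<not> E w \<and> d v \<noteq> d w \<longrightarrow> c v \<noteq> c w \<and> e v \<noteq> e w)
    \<and> (\<not> C v \<and> \<not> D v \<and> \<not> C w \<and> \<not> D w \<and> e v \<noteq> e w \<longrightarrow> c v \<noteq> c w \<and> d v \<noteq> d w)"

definition several :: "'v set \<Rightarrow> ('v \<Rightarrow> bool) \<Rightarrow> ('v \<Rightarrow> 'l) \<Rightarrow> ('v \<Rightarrow> bool) \<Rightarrow> ('v \<Rightarrow> bool) \<Rightarrow> bool" where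
  "several V P c D E \<longleftrightarrow>
    (\<exists>v\<in>V. \<exists>w\<in>V. P v \<and> P w \<and> \<not> D v \<and> \<not> E v \<and> \<not> D w \<and> \<not> E w \<and> c v \<noteq> c w)"

text \<open>Unfolding \<open>sorted_wrt\<close> on an explicit list turns a pairwise hypothesis into
  the conjunction of its ground instances, one for each unordered pair; this keeps quantifiers away
  from the solver.\<close>

lemma sorted_wrt_on:
  assumes "\<And>v w. v \<in> V \<Longrightarrow> w \<in> V \<Longrightarrow> q v w \<Longrightarrow> r v w"
  shows "set vs \<subseteq> V \<Longrightarrow> sorted_wrt (\<lambda>v w. q v w \<longrightarrow> r v w) vs"
  by (induction vs) (use assms in auto)

text \<open>\<open>P\<close> selects one side of the bipartite graph; \<open>c v\<close>, \<open>d v\<close>, \<open>e v\<close> are the components of \<open>v\<close> in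
  the
  three colours, and \<open>C\<close>, \<open>D\<close>, \<open>E\<close> the vertices that are chosen to cover the edges of these colours.
  The last three axioms are the minimality of the covers: an edge \<open>{v, w}\<close> is covered by \<open>v\<close> only.\<close>

locale cover_system =
  fixes V :: "'v set" and P :: "'v \<Rightarrow> bool" and c d e :: "'v \<Rightarrow> 'l" and C D E :: "'v \<Rightarrow> bool"
    and s t u n :: nat
  assumes finite_V: "finite V"
    and card_left: "card {v \<in> V. P v} = n" and card_right: "card {v \<in> V. \<not> P v} = n"
    and agree: "v \<in> V \<Longrightarrow> w \<in> V \<Longrightarrow> P v \<noteq> P w \<Longrightarrow>
      c v = c w \<and> (C v \<or> C w) \<or> d v = d w \<and> (D v \<or> D w) \<or> e v = e w \<and> (E v \<or> E w)"
    and cap_C: "card {v \<in> V. C v \<and> c v = i} \<le> s"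
    and cap_D: "card {v \<in> V. D v \<and> d v = i} \<le> t"
    and cap_E: "card {v \<in> V. E v \<and> e v = i} \<le> u"
    and large: "s + t + u < n"
    and min_C: "v \<in> V \<Longrightarrow> C v \<Longrightarrow> \<exists>w\<in>V. P v \<noteq> P w \<and> c v = c w \<and> \<not> C w
        \<and> \<not> (d v = d w \<and> (D v \<or> D w)) \<and> \<not> (e v = e w \<and> (E v \<or> E w))"
    and min_D: "v \<in> V \<Longrightarrow> D v \<Longrightarrow> \<exists>w\<in>V. P v \<noteq> P w \<and> d v = d w \<and> \<not> D w
        \<and> \<not> (c v = c w \<and> (C v \<or> C w)) \<and> \<not> (e v = e w \<and> (E v \<or> E w))"
    and min_E: "v \<in> V \<Longrightarrow> E v \<Longrightarrow> \<exists>w\<in>V. P v \<noteq> P w \<and> e v = e w \<and> \<not> E w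
        \<and> \<not> (c v = c w \<and> (C v \<or> C w)) \<and> \<not> (d v = d w \<and> (D v \<or> D w))"
begin

text \<open>Exchanging the sides and the two transpositions of colours below generate all twelve
  symmetries of the axioms, so a configuration has to be refuted in one position only.\<close>

lemma flip_sides: "cover_system V (\<lambda>v. \<not> P v) c d e C D E s t u n"
proof
  show "finite V" by (fact finite_V)
  show "card {v \<in> V. \<not> P v} = n" "card {v \<in> V. \<not> \<not> P v} = n"
    using card_left card_right by simp_all
  show "card {v \<in> V. C v \<and> c v = i} \<le> s" "card {v \<in> V. D v \<and> d v = i} \<le> t"
    "card {v \<in> V. E v \<and> e v = i} \<le> u" for i
    by (fact cap_C cap_D cap_E)+
  show "s + t + u < n" using large by simp
qed (use agree in blast, use min_C in blast, use min_D in blast, use min_E in blast)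

lemma swap_CD: "cover_system V P d c e D C E t s u n"
proof
  show "finite V" by (fact finite_V)
  show "card {v \<in> V. P v} = n" "card {v \<in> V. \<not> P v} = n"
    using card_left card_right by simp_all
  show "card {v \<in> V. D v \<and> d v = i} \<le> t" "card {v \<in> V. C v \<and> c v = i} \<le> s"
    "card {v \<in> V. E v \<and> e v = i} \<le> u" for i
    by (fact cap_C cap_D cap_E)+
  show "t + s + u < n" using large by simp
qed (use agree in blast, use min_D in blast, use min_C in blast, use min_E in blast)

lemma swap_DE: "cover_system V P c e d C E D s u t n"
proof
  show "finite V" by (fact finite_V)
  show "card {v \<in> V. P v} = n" "card {v \<in> V. \<not> P v} = n"
    using card_left card_right by simp_all
  show "card {v \<in> V. C v \<and> c v = i} \<le> s" "card {v \<in> V. E v \<and> e v = i} \<le> u"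
    "card {v \<in> V. D v \<and> d v = i} \<le> t" for i
    by (fact cap_C cap_D cap_E)+
  show "s + u + t < n" using large by simp
qed (use agree in blast, use min_C in blast, use min_E in blast, use min_D in blast)

section \<open>Light vertices by averaging\<close>

definition light :: "nat \<Rightarrow> nat \<Rightarrow> 'l list \<Rightarrow> 'l list \<Rightarrow> 'l list \<Rightarrow> 'v \<Rightarrow> bool" where
  "light p q cs ds es v \<longleftrightarrow>
    weight (C v) cs (c v) + weight (D v) ds (d v) + weight (E v) es (e v) < (if P v then p else q)"

lemma light_1_1: "light 1 1 cs ds es v \<longleftrightarrow> \<not> (C v \<and> c v \<in> set cs) \<and> \<not> (D v \<and> d v \<in> set ds)
    \<and> \<not> (E v \<and> e v \<in> set es)"
  unfolding light_def one_le_weight[symmetric] by auto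

text \<open>A sum of three natural numbers is below 2 iff none reaches 2 and no two reach 1. With
  this and the \<open>weight\<close> lemmas, lightness becomes a Boolean combination of label
  equations, free of arithmetic.\<close>

lemma light_1_2: "light 1 2 cs ds es v \<longleftrightarrow> (if P v then light 1 1 cs ds es v else
    \<not> 2 \<le> weight (C v) cs (c v) \<and> \<not> 2 \<le> weight (D v) ds (d v) \<and> \<not> 2 \<le> weight (E v) es (e v)
    \<and> \<not> (C v \<and> c v \<in> set cs \<and> D v \<and> d v \<in> set ds) \<and> \<not> (C v \<and> c v \<in> set cs \<and> E v \<and> e v \<in> set es)
    \<and> \<not> (D v \<and> d v \<in> set ds \<and> E v \<and> e v \<in> set es))"
proof -
  have less_2: "x + y + z < 2 \<longleftrightarrow> \<not> 2 \<le> x \<and> \<not> 2 \<le> y \<and> \<not> 2 \<le> z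
    \<and> \<not> (1 \<le> x \<and> 1 \<le> y) \<and> \<not> (1 \<le> x \<and> 1 \<le> z) \<and> \<not> (1 \<le> y \<and> 1 \<le> z)" for x y z :: nat
    by presburger
  show ?thesis
    by (simp add: light_def less_2 one_le_weight del: One_nat_def)
qed

lemma light_1_3: "light 1 3 cs ds es v \<longleftrightarrow> (if P v then light 1 1 cs ds es v else
    \<not> 3 \<le> weight (C v) cs (c v) \<and> \<not> 3 \<le> weight (D v) ds (d v) \<and> \<not> 3 \<le> weight (E v) es (e v)
    \<and> \<not> (2 \<le> weight (C v) cs (c v) \<and> (D v \<and> d v \<in> set ds \<or> E v \<and> e v \<in> set es))
    \<and> \<not> (2 \<le> weight (D v) ds (d v) \<and> (C v \<and> c v \<in> set cs \<or> E v \<and> e v \<in> set es))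
    \<and> \<not> (2 \<le> weight (E v) es (e v) \<and> (C v \<and> c v \<in> set cs \<or> D v \<and> d v \<in> set ds))
    \<and> \<not> (C v \<and> c v \<in> set cs \<and> D v \<and> d v \<in> set ds \<and> E v \<and> e v \<in> set es))"
proof -
  have less_3: "x + y + z < 3 \<longleftrightarrow> \<not> 3 \<le> x \<and> \<not> 3 \<le> y \<and> \<not> 3 \<le> z
    \<and> \<not> (2 \<le> x \<and> (1 \<le> y \<or> 1 \<le> z)) \<and> \<not> (2 \<le> y \<and> (1 \<le> x \<or> 1 \<le> z)) \<and> \<not> (2 \<le> z \<and> (1 \<le> x \<or> 1 \<le> y))
    \<and> \<not> (1 \<le> x \<and> 1 \<le> y \<and> 1 \<le> z)" for x y z :: nat
    by presburger
  show ?thesis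
    by (simp add: light_def less_3 one_le_weight del: One_nat_def)
qed

lemma light_vertex:
  assumes "length cs * s + length ds * t + length es * u < (p + q) * n"
  obtains v where "v \<in> V" "light p q cs ds es v"
proof -
  define w where "w v = weight (C v) cs (c v) + weight (D v) ds (d v) + weight (E v) es (e v)" for v
  have "\<exists>v\<in>V. w v < (if P v then p else q)"
  proof (rule ccontr)
    assume "\<not> ?thesis"
    then have "(\<Sum>v\<in>V. if P v then p else q) \<le> (\<Sum>v\<in>V. w v)"
      by (intro sum_mono) (metis not_le)
    also have "\<dots> \<le> length cs * s + length ds * t + length es * u"
      unfolding w_def sum.distrib
      by (intro add_mono sum_weight_le finite_V cap_C cap_D cap_E)
    finally show False
      using assms finite_V card_left card_right by (simp add: sum.If_cases Int_def distrib_left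
        mult.commute)
  qed
  then show ?thesis using that by (auto simp: w_def light_def)
qed

lemma light_vertex_equal:
  assumes "length cs = p + q" "length ds = p + q" "length es = p + q" "0 < p + q"
  obtains v where "v \<in> V" "light p q cs ds es v"
proof (rule light_vertex[of cs ds es p q])
  show "length cs * s + length ds * t + length es * u < (p + q) * n"
    using large assms by (metis distrib_left mult_less_cancel1)
qed (use that in auto)

text \<open>No weight is below 0, so splitting 1 as 1 + 0 forces the light vertex onto the left
  side.\<close>

lemma avoid_left:
  obtains v where "v \<in> V" "P v" "\<not> (C v \<and> c v = i)" "\<not> (D v \<and> d v = j)" "\<not> (E v \<and> e v = k)"
  by (rule light_vertex_equal[of "[i]" 1 0 "[j]" "[k]"]) (auto simp: light_def weight_def split:
    if_splits)

lemma avoid_right: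
  obtains v where "v \<in> V" "\<not> P v" "\<not> (C v \<and> c v = i)" "\<not> (D v \<and> d v = j)" "\<not> (E v \<and> e v = k)"
  by (rule light_vertex_equal[of "[i]" 0 1 "[j]" "[k]"]) (auto simp: light_def weight_def split:
    if_splits)

text \<open>The split 1 + 1 allows two components of each colour to be avoided, but leaves the side
  of the vertex open; every use has to deal with both sides.\<close>

lemma avoid_pairs:
  obtains v where "v \<in> V" "\<not> (C v \<and> (c v = i \<or> c v = i'))" "\<not> (D v \<and> (d v = j \<or> d v = j'))"
    "\<not> (E v \<and> (e v = k \<or> e v = k'))"
  by (rule light_vertex_equal[of "[i, i']" 1 1 "[j, j']" "[k, k']"])
    (auto simp: light_def weight_def split: if_splits)

lemma coloured:
  assumes "v \<in> V"
  shows "C v \<or> D v \<or> E v"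
proof (rule ccontr)
  assume neg: "\<not> ?thesis"
  obtain w where "w \<in> V" "P w \<noteq> P v" "\<not> (C w \<and> c w = c v)" "\<not> (D w \<and> d w = d v)" "\<not> (E w \<and> e w = e
    v)"
    by (cases "P v") (use avoid_left avoid_right in metis)+
  then show False using agree[of v w] assms neg by auto
qed

text \<open>Any \<open>w\<close> serves if \<open>v\<close> is not in the cover. This total form
  introduces a witness before it is known whether \<open>v\<close> is covered and leaves that
  distinction to the solver.\<close>

lemma witness_C:
  assumes "v \<in> V"
  obtains w where "w \<in> V" "C v \<longrightarrow> P v \<noteq> P w \<and> c v = c w \<and> \<not> C w
    \<and> \<not> (d v = d w \<and> (D v \<or> D w)) \<and> \<not> (e v = e w \<and> (E v \<or> E w))"
  using assms min_C by blast

lemma witness_D: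
  assumes "v \<in> V"
  obtains w where "w \<in> V" "D v \<longrightarrow> P v \<noteq> P w \<and> d v = d w \<and> \<not> D w
    \<and> \<not> (c v = c w \<and> (C v \<or> C w)) \<and> \<not> (e v = e w \<and> (E v \<or> E w))"
  using assms min_D by blast

lemma witness_E:
  assumes "v \<in> V"
  obtains w where "w \<in> V" "E v \<longrightarrow> P v \<noteq> P w \<and> e v = e w \<and> \<not> E w
    \<and> \<not> (c v = c w \<and> (C v \<or> C w)) \<and> \<not> (d v = d w \<and> (D v \<or> D w))"
  using assms min_E by blast

abbreviation alike :: "'v \<Rightarrow> 'v \<Rightarrow> bool" where "alike \<equiv> alike_singles c d e C D E"

abbreviation misaligned :: "'v \<Rightarrow> 'v \<Rightarrow> bool" where "misaligned \<equiv> misaligned_singles c d e C D E"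

abbreviation monochrome :: "'v \<Rightarrow> 'v \<Rightarrow> bool" where "monochrome \<equiv> monochrome_singles C D E"

abbreviation spread :: "'v \<Rightarrow> 'v \<Rightarrow> bool" where "spread \<equiv> spread_singles c d e C D E"

definition joined :: "'v \<Rightarrow> 'v \<Rightarrow> bool" where
  "joined v w \<longleftrightarrow> P v = P w \<or> c v = c w \<and> (C v \<or> C w) \<or> d v = d w \<and> (D v \<or> D w)
    \<or> e v = e w \<and> (E v \<or> E w)"

definition chromatic :: "'v \<Rightarrow> bool" where
  "chromatic v \<longleftrightarrow> C v \<or> D v \<or> E v"

lemma joined_list: "set vs \<subseteq> V \<Longrightarrow> sorted_wrt joined vs"
  by (induction vs) (use agree in \<open>auto simp: joined_def\<close>)

lemma chromatic_list: "set vs \<subseteq> V \<Longrightarrow> list_all chromatic vs"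
  by (induction vs) (use coloured in \<open>auto simp: chromatic_def\<close>)

subsection \<open>Vertices covered in one colour only\<close>

text \<open>In the lemmas closed by the SMT solver, the light vertices and the minimality witnesses were
  found by a computer search, minimising a set of vertices that admits no consistent pattern of
  covers and coincidences of components.\<close>

lemma aligned_singles:
  assumes alike: "\<And>v w. v \<in> V \<Longrightarrow> w \<in> V \<Longrightarrow> P v = P w \<Longrightarrow> alike v w"
    and r0: "r0 \<in> V" "P r0" "C r0" "\<not> D r0" "\<not> E r0"
    and r1: "r1 \<in> V" "\<not> P r1" "\<not> C r1" "\<not> D r1" "E r1" "c r0 = c r1" "d r0 = d r1"
  shows False
proof -
  obtain v0 where v0: "v0 \<in> V" "P v0" "\<not> (C v0 \<and> c v0 = c r0)"
    "\<not> (D v0 \<and> d v0 = d r0)" "\<not> (E v0 \<and> e v0 = e r1)"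
    by (rule avoid_left)
  obtain v1 where v1: "v1 \<in> V" "\<not> (C v1 \<and> (c v1 = c r0 \<or> c v1 = c v0))"
    "\<not> (D v1 \<and> (d v1 = d r0 \<or> d v1 = d v0))" "\<not> (E v1 \<and> (e v1 = e r0 \<or> e v1 = e r1))"
    by (rule avoid_pairs)
  obtain v2 where v2: "v2 \<in> V" "\<not> (C v2 \<and> (c v2 = c r0 \<or> c v2 = c v1))"
    "\<not> (D v2 \<and> (d v2 = d r0 \<or> d v2 = d v0))" "\<not> (E v2 \<and> (e v2 = e r0 \<or> e v2 = e r1))"
    by (rule avoid_pairs)
  obtain v3 where v3: "v3 \<in> V" "\<not> P v3" "\<not> (C v3 \<and> c v3 = c v0)"
    "\<not> (D v3 \<and> d v3 = d v1)" "\<not> (E v3 \<and> e v3 = e r1)"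
    by (rule avoid_right)
  obtain v4 where v4: "v4 \<in> V" "\<not> (C v4 \<and> (c v4 = c r0 \<or> c v4 = c v0))"
    "\<not> (D v4 \<and> (d v4 = d r0 \<or> d v4 = d v1))" "\<not> (E v4 \<and> (e v4 = e r0 \<or> e v4 = e r1))"
    by (rule avoid_pairs)
  obtain v5 where v5: "v5 \<in> V" "C v0 \<longrightarrow> P v0 \<noteq> P v5 \<and> c v0 = c v5 \<and> \<not> C v5
      \<and> \<not> (d v0 = d v5 \<and> (D v0 \<or> D v5)) \<and> \<not> (e v0 = e v5 \<and> (E v0 \<or> E v5))"
    by (rule witness_C[OF v0(1)])
  let ?vs = "[r0, r1, v0, v1, v2, v3, v4, v5]"
  have in_V: "set ?vs \<subseteq> V"
    using r0(1) r1(1) v0(1) v1(1) v2(1) v3(1) v4(1) v5(1) by simp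
  have "sorted_wrt (\<lambda>v w. P v = P w \<longrightarrow> alike v w) ?vs"
    by (rule sorted_wrt_on[OF _ in_V]) (use alike in blast)
  then show False
    using chromatic_list[OF in_V] joined_list[OF in_V] r0 r1 v0 v1 v2 v3 v4 v5
    unfolding list.pred_inject sorted_wrt.simps list.set ball_simps
      chromatic_def joined_def alike_singles_def
    by (smt (z3))
qed

text \<open>Second stage, with \<open>d r0 \<noteq> d r1\<close> by the first. The hypothesis
  \<open>misaligned\<close> also constrains all other opposite pairs of singles of different
  colours.\<close>

lemma different_singles:
  assumes alike: "\<And>v w. v \<in> V \<Longrightarrow> w \<in> V \<Longrightarrow> P v = P w \<Longrightarrow> alike v w"
    and misaligned: "\<And>v w. v \<in> V \<Longrightarrow> w \<in> V \<Longrightarrow> P v \<noteq> P w \<Longrightarrow> misaligned v w"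
    and r0: "r0 \<in> V" "P r0" "C r0" "\<not> D r0" "\<not> E r0"
    and r1: "r1 \<in> V" "\<not> P r1" "\<not> C r1" "\<not> D r1" "E r1" "c r0 = c r1"
  shows False
proof -
  obtain v0 where v0: "v0 \<in> V" "P v0" "\<not> (C v0 \<and> c v0 = c r0)"
    "\<not> (D v0 \<and> d v0 = d r1)" "\<not> (E v0 \<and> e v0 = e r1)"
    by (rule avoid_left)
  obtain v1 where v1: "v1 \<in> V" "\<not> (C v1 \<and> (c v1 = c r0 \<or> c v1 = c v0))"
    "\<not> (D v1 \<and> (d v1 = d r0 \<or> d v1 = d r1))" "\<not> (E v1 \<and> (e v1 = e r0 \<or> e v1 = e r1))"
    by (rule avoid_pairs)
  obtain v2 where v2: "v2 \<in> V" "C v0 \<longrightarrow> P v0 \<noteq> P v2 \<and> c v0 = c v2 \<and> \<not> C v2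
      \<and> \<not> (d v0 = d v2 \<and> (D v0 \<or> D v2)) \<and> \<not> (e v0 = e v2 \<and> (E v0 \<or> E v2))"
    by (rule witness_C[OF v0(1)])
  obtain v3 where v3: "v3 \<in> V" "D v0 \<longrightarrow> P v0 \<noteq> P v3 \<and> d v0 = d v3 \<and> \<not> D v3
      \<and> \<not> (c v0 = c v3 \<and> (C v0 \<or> C v3)) \<and> \<not> (e v0 = e v3 \<and> (E v0 \<or> E v3))"
    by (rule witness_D[OF v0(1)])
  obtain v4 where v4: "v4 \<in> V" "D v1 \<longrightarrow> P v1 \<noteq> P v4 \<and> d v1 = d v4 \<and> \<not> D v4
      \<and> \<not> (c v1 = c v4 \<and> (C v1 \<or> C v4)) \<and> \<not> (e v1 = e v4 \<and> (E v1 \<or> E v4))"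
    by (rule witness_D[OF v1(1)])
  obtain v5 where v5: "v5 \<in> V" "D v2 \<longrightarrow> P v2 \<noteq> P v5 \<and> d v2 = d v5 \<and> \<not> D v5
      \<and> \<not> (c v2 = c v5 \<and> (C v2 \<or> C v5)) \<and> \<not> (e v2 = e v5 \<and> (E v2 \<or> E v5))"
    by (rule witness_D[OF v2(1)])
  obtain v6 where v6: "v6 \<in> V" "\<not> (C v6 \<and> (c v6 = c r0 \<or> c v6 = c v0))"
    "\<not> (D v6 \<and> (d v6 = d r1 \<or> d v6 = d v0))" "\<not> (E v6 \<and> (e v6 = e r0 \<or> e v6 = e r1))"
    by (rule avoid_pairs)
  obtain v7 where v7: "v7 \<in> V" "D v6 \<longrightarrow> P v6 \<noteq> P v7 \<and> d v6 = d v7 \<and> \<not> D v7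
      \<and> \<not> (c v6 = c v7 \<and> (C v6 \<or> C v7)) \<and> \<not> (e v6 = e v7 \<and> (E v6 \<or> E v7))"
    by (rule witness_D[OF v6(1)])
  obtain v8 where v8: "v8 \<in> V" "\<not> (C v8 \<and> (c v8 = c r0 \<or> c v8 = c v6))"
    "\<not> (D v8 \<and> (d v8 = d r1 \<or> d v8 = d v0))" "\<not> (E v8 \<and> (e v8 = e r0 \<or> e v8 = e r1))"
    by (rule avoid_pairs)
  obtain v9 where v9: "v9 \<in> V" "\<not> (C v9 \<and> (c v9 = c r0 \<or> c v9 = c v0))"
    "\<not> (D v9 \<and> (d v9 = d r1 \<or> d v9 = d v0))" "\<not> (E v9 \<and> (e v9 = e r1 \<or> e v9 = e v1))"
    by (rule avoid_pairs)
  obtain v10 where v10: "v10 \<in> V" "\<not> (C v10 \<and> (c v10 = c r0 \<or> c v10 = c v0))"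
    "\<not> (D v10 \<and> (d v10 = d r0 \<or> d v10 = d v0))" "\<not> (E v10 \<and> (e v10 = e r0 \<or> e v10 = e r1))"
    by (rule avoid_pairs)
  obtain v11 where v11: "v11 \<in> V" "E v1 \<longrightarrow> P v1 \<noteq> P v11 \<and> e v1 = e v11 \<and> \<not> E v11
      \<and> \<not> (c v1 = c v11 \<and> (C v1 \<or> C v11)) \<and> \<not> (d v1 = d v11 \<and> (D v1 \<or> D v11))"
    by (rule witness_E[OF v1(1)])
  let ?vs = "[r0, r1, v0, v1, v2, v3, v4, v5, v6, v7, v8, v9, v10, v11]"
  have in_V: "set ?vs \<subseteq> V"
    using r0(1) r1(1) v0(1) v1(1) v2(1) v3(1) v4(1) v5(1) v6(1) v7(1) v8(1) v9(1) v10(1) v11(1) by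
      simp
  have "sorted_wrt (\<lambda>v w. P v = P w \<longrightarrow> alike v w) ?vs"
    by (rule sorted_wrt_on[OF _ in_V]) (use alike in blast)
  moreover have "sorted_wrt (\<lambda>v w. P v \<noteq> P w \<longrightarrow> misaligned v w) ?vs"
    by (rule sorted_wrt_on[OF _ in_V]) (use misaligned in blast)
  ultimately show False
    using chromatic_list[OF in_V] joined_list[OF in_V] r0 r1 v0 v1 v2 v3 v4 v5 v6 v7 v8 v9 v10 v11
    unfolding list.pred_inject sorted_wrt.simps list.set ball_simps
      chromatic_def joined_def alike_singles_def misaligned_singles_def
    by (smt (z3))
qed

text \<open>Once opposite singles share their colour, a right vertex \<open>r1\<close> that is
  covered in no component of the single \<open>r0\<close> must lie in both other covers.
  \<open>r2\<close> is its witness for \<open>E\<close>. This lemma and the next three are the four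
  cases given by \<open>d r2 = d r0\<close> and \<open>C r2\<close>, each with its own choice of
  light vertices.\<close>

lemma double_same_other:
  assumes alike: "\<And>v w. v \<in> V \<Longrightarrow> w \<in> V \<Longrightarrow> P v = P w \<Longrightarrow> alike v w"
    and monochrome: "\<And>v w. v \<in> V \<Longrightarrow> w \<in> V \<Longrightarrow> P v \<noteq> P w \<Longrightarrow> monochrome v w"
    and r0: "r0 \<in> V" "P r0" "C r0" "\<not> D r0" "\<not> E r0"
    and r1: "r1 \<in> V" "\<not> P r1" "\<not> C r1" "D r1" "E r1" "c r0 = c r1" "d r0 \<noteq> d r1" "e r0 \<noteq> e r1"
    and r2: "r2 \<in> V" "P r2" "e r1 = e r2" "\<not> E r2" "\<not> (c r1 = c r2 \<and> C r2)" "d r1 \<noteq> d r2"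
      "d r2 = d r0" "\<not> C r2"
  shows False
proof -
  obtain v0 where v0: "v0 \<in> V" "\<not> P v0" "\<not> (C v0 \<and> c v0 = c r0)"
    "\<not> (D v0 \<and> d v0 = d r2)" "\<not> (E v0 \<and> e v0 = e r1)"
    by (rule avoid_right)
  obtain v1 where v1: "v1 \<in> V" "\<not> (C v1 \<and> (c v1 = c r0 \<or> c v1 = c v0))"
    "\<not> (D v1 \<and> (d v1 = d r1 \<or> d v1 = d r2))" "\<not> (E v1 \<and> (e v1 = e r0 \<or> e v1 = e r1))"
    by (rule avoid_pairs)
  obtain v2 where v2: "v2 \<in> V" "\<not> (C v2 \<and> (c v2 = c r0 \<or> c v2 = c v0))"
    "\<not> (D v2 \<and> (d v2 = d r1 \<or> d v2 = d r2))" "\<not> (E v2 \<and> (e v2 = e r1 \<or> e v2 = e v1))"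
    by (rule avoid_pairs)
  obtain v3 where v3: "v3 \<in> V" "\<not> (C v3 \<and> (c v3 = c r0 \<or> c v3 = c r2))"
    "\<not> (D v3 \<and> (d v3 = d r0 \<or> d v3 = d r1))" "\<not> (E v3 \<and> (e v3 = e r0 \<or> e v3 = e r1))"
    by (rule avoid_pairs)
  obtain v4 where v4: "v4 \<in> V" "D r2 \<longrightarrow> P r2 \<noteq> P v4 \<and> d r2 = d v4 \<and> \<not> D v4
      \<and> \<not> (c r2 = c v4 \<and> (C r2 \<or> C v4)) \<and> \<not> (e r2 = e v4 \<and> (E r2 \<or> E v4))"
    by (rule witness_D[OF r2(1)])
  obtain v5 where v5: "v5 \<in> V" "C r2 \<longrightarrow> P r2 \<noteq> P v5 \<and> c r2 = c v5 \<and> \<not> C v5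
      \<and> \<not> (d r2 = d v5 \<and> (D r2 \<or> D v5)) \<and> \<not> (e r2 = e v5 \<and> (E r2 \<or> E v5))"
    by (rule witness_C[OF r2(1)])
  obtain v6 where v6: "v6 \<in> V" "\<not> (C v6 \<and> (c v6 = c r0 \<or> c v6 = c r2))"
    "\<not> (D v6 \<and> (d v6 = d r0 \<or> d v6 = d r1))" "\<not> (E v6 \<and> (e v6 = e r0 \<or> e v6 = e v4))"
    by (rule avoid_pairs)
  obtain v7 where v7: "v7 \<in> V" "\<not> (C v7 \<and> (c v7 = c r0 \<or> c v7 = c r2))"
    "\<not> (D v7 \<and> (d v7 = d r0 \<or> d v7 = d r1))" "\<not> (E v7 \<and> (e v7 = e v4 \<or> e v7 = e v6))"
    by (rule avoid_pairs)
  obtain v8 where v8: "v8 \<in> V" "\<not> (C v8 \<and> (c v8 = c r0 \<or> c v8 = c v4))"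
    "\<not> (D v8 \<and> (d v8 = d r0 \<or> d v8 = d r1))" "\<not> (E v8 \<and> (e v8 = e r0 \<or> e v8 = e r1))"
    by (rule avoid_pairs)
  obtain v9 where v9: "v9 \<in> V" "\<not> (C v9 \<and> (c v9 = c r0 \<or> c v9 = c v4))"
    "\<not> (D v9 \<and> (d v9 = d r0 \<or> d v9 = d r1))" "\<not> (E v9 \<and> (e v9 = e r0 \<or> e v9 = e v8))"
    by (rule avoid_pairs)
  obtain v10 where v10: "v10 \<in> V" "\<not> (C v10 \<and> (c v10 = c r0 \<or> c v10 = c r2))"
    "\<not> (D v10 \<and> (d v10 = d r0 \<or> d v10 = d r1))" "\<not> (E v10 \<and> (e v10 = e r0 \<or> e v10 = e v5))"
    by (rule avoid_pairs)
  obtain v11 where v11: "v11 \<in> V" "C v10 \<longrightarrow> P v10 \<noteq> P v11 \<and> c v10 = c v11 \<and> \<not> C v11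
      \<and> \<not> (d v10 = d v11 \<and> (D v10 \<or> D v11)) \<and> \<not> (e v10 = e v11 \<and> (E v10 \<or> E v11))"
    by (rule witness_C[OF v10(1)])
  obtain v12 where v12: "v12 \<in> V" "E v10 \<longrightarrow> P v10 \<noteq> P v12 \<and> e v10 = e v12 \<and> \<not> E v12
      \<and> \<not> (c v10 = c v12 \<and> (C v10 \<or> C v12)) \<and> \<not> (d v10 = d v12 \<and> (D v10 \<or> D v12))"
    by (rule witness_E[OF v10(1)])
  obtain v13 where v13: "v13 \<in> V" "E v3 \<longrightarrow> P v3 \<noteq> P v13 \<and> e v3 = e v13 \<and> \<not> E v13
      \<and> \<not> (c v3 = c v13 \<and> (C v3 \<or> C v13)) \<and> \<not> (d v3 = d v13 \<and> (D v3 \<or> D v13))"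
    by (rule witness_E[OF v3(1)])
  let ?vs = "[r0, r1, r2, v0, v1, v2, v3, v4, v5, v6, v7, v8, v9, v10, v11, v12, v13]"
  have in_V: "set ?vs \<subseteq> V"
    using r0(1) r1(1) r2(1) v0(1) v1(1) v2(1) v3(1) v4(1) v5(1) v6(1) v7(1) v8(1) v9(1) v10(1)
      v11(1) v12(1) v13(1) by simp
  have "sorted_wrt (\<lambda>v w. P v = P w \<longrightarrow> alike v w) ?vs"
    by (rule sorted_wrt_on[OF _ in_V]) (use alike in blast)
  moreover have "sorted_wrt (\<lambda>v w. P v \<noteq> P w \<longrightarrow> monochrome v w) ?vs"
    by (rule sorted_wrt_on[OF _ in_V]) (use monochrome in blast)
  ultimately show False
    using chromatic_list[OF in_V] joined_list[OF in_V] r0 r1 r2 v0 v1 v2 v3 v4 v5 v6 v7 v8 v9 v10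
      v11 v12 v13
    unfolding list.pred_inject sorted_wrt.simps list.set ball_simps
      chromatic_def joined_def alike_singles_def monochrome_singles_def
    by (smt (z3))
qed

lemma double_same_C:
  assumes alike: "\<And>v w. v \<in> V \<Longrightarrow> w \<in> V \<Longrightarrow> P v = P w \<Longrightarrow> alike v w"
    and monochrome: "\<And>v w. v \<in> V \<Longrightarrow> w \<in> V \<Longrightarrow> P v \<noteq> P w \<Longrightarrow> monochrome v w"
    and r0: "r0 \<in> V" "P r0" "C r0" "\<not> D r0" "\<not> E r0"
    and r1: "r1 \<in> V" "\<not> P r1" "\<not> C r1" "D r1" "E r1" "c r0 = c r1" "d r0 \<noteq> d r1" "e r0 \<noteq> e r1"
    and r2: "r2 \<in> V" "P r2" "e r1 = e r2" "\<not> E r2" "\<not> (c r1 = c r2 \<and> C r2)" "d r1 \<noteq> d r2"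
      "d r2 = d r0" "C r2"
  shows False
proof -
  obtain v0 where v0: "v0 \<in> V" "\<not> (C v0 \<and> (c v0 = c r0 \<or> c v0 = c r2))"
    "\<not> (D v0 \<and> (d v0 = d r0 \<or> d v0 = d r1))" "\<not> (E v0 \<and> (e v0 = e r0 \<or> e v0 = e r1))"
    by (rule avoid_pairs)
  obtain v1 where v1: "v1 \<in> V" "D r2 \<longrightarrow> P r2 \<noteq> P v1 \<and> d r2 = d v1 \<and> \<not> D v1
      \<and> \<not> (c r2 = c v1 \<and> (C r2 \<or> C v1)) \<and> \<not> (e r2 = e v1 \<and> (E r2 \<or> E v1))"
    by (rule witness_D[OF r2(1)])
  obtain v2 where v2: "v2 \<in> V" "C r2 \<longrightarrow> P r2 \<noteq> P v2 \<and> c r2 = c v2 \<and> \<not> C v2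
      \<and> \<not> (d r2 = d v2 \<and> (D r2 \<or> D v2)) \<and> \<not> (e r2 = e v2 \<and> (E r2 \<or> E v2))"
    by (rule witness_C[OF r2(1)])
  obtain v3 where v3: "v3 \<in> V" "\<not> (C v3 \<and> (c v3 = c r0 \<or> c v3 = c r2))"
    "\<not> (D v3 \<and> (d v3 = d r0 \<or> d v3 = d r1))" "\<not> (E v3 \<and> (e v3 = e r0 \<or> e v3 = e v1))"
    by (rule avoid_pairs)
  obtain v4 where v4: "v4 \<in> V" "\<not> (C v4 \<and> (c v4 = c r0 \<or> c v4 = c r2))"
    "\<not> (D v4 \<and> (d v4 = d r0 \<or> d v4 = d r1))" "\<not> (E v4 \<and> (e v4 = e v1 \<or> e v4 = e v3))"
    by (rule avoid_pairs)
  obtain v5 where v5: "v5 \<in> V" "D v2 \<longrightarrow> P v2 \<noteq> P v5 \<and> d v2 = d v5 \<and> \<not> D v5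
      \<and> \<not> (c v2 = c v5 \<and> (C v2 \<or> C v5)) \<and> \<not> (e v2 = e v5 \<and> (E v2 \<or> E v5))"
    by (rule witness_D[OF v2(1)])
  obtain v6 where v6: "v6 \<in> V" "E v0 \<longrightarrow> P v0 \<noteq> P v6 \<and> e v0 = e v6 \<and> \<not> E v6
      \<and> \<not> (c v0 = c v6 \<and> (C v0 \<or> C v6)) \<and> \<not> (d v0 = d v6 \<and> (D v0 \<or> D v6))"
    by (rule witness_E[OF v0(1)])
  obtain v7 where v7: "v7 \<in> V" "D v0 \<longrightarrow> P v0 \<noteq> P v7 \<and> d v0 = d v7 \<and> \<not> D v7
      \<and> \<not> (c v0 = c v7 \<and> (C v0 \<or> C v7)) \<and> \<not> (e v0 = e v7 \<and> (E v0 \<or> E v7))"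
    by (rule witness_D[OF v0(1)])
  let ?vs = "[r0, r1, r2, v0, v1, v2, v3, v4, v5, v6, v7]"
  have in_V: "set ?vs \<subseteq> V"
    using r0(1) r1(1) r2(1) v0(1) v1(1) v2(1) v3(1) v4(1) v5(1) v6(1) v7(1) by simp
  have "sorted_wrt (\<lambda>v w. P v = P w \<longrightarrow> alike v w) ?vs"
    by (rule sorted_wrt_on[OF _ in_V]) (use alike in blast)
  moreover have "sorted_wrt (\<lambda>v w. P v \<noteq> P w \<longrightarrow> monochrome v w) ?vs"
    by (rule sorted_wrt_on[OF _ in_V]) (use monochrome in blast)
  ultimately show False
    using chromatic_list[OF in_V] joined_list[OF in_V] r0 r1 r2 v0 v1 v2 v3 v4 v5 v6 v7
    unfolding list.pred_inject sorted_wrt.simps list.set ball_simps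
      chromatic_def joined_def alike_singles_def monochrome_singles_def
    by (smt (z3))
qed

lemma double_new_other:
  assumes alike: "\<And>v w. v \<in> V \<Longrightarrow> w \<in> V \<Longrightarrow> P v = P w \<Longrightarrow> alike v w"
    and monochrome: "\<And>v w. v \<in> V \<Longrightarrow> w \<in> V \<Longrightarrow> P v \<noteq> P w \<Longrightarrow> monochrome v w"
    and r0: "r0 \<in> V" "P r0" "C r0" "\<not> D r0" "\<not> E r0"
    and r1: "r1 \<in> V" "\<not> P r1" "\<not> C r1" "D r1" "E r1" "c r0 = c r1" "d r0 \<noteq> d r1" "e r0 \<noteq> e r1"
    and r2: "r2 \<in> V" "P r2" "e r1 = e r2" "\<not> E r2" "\<not> (c r1 = c r2 \<and> C r2)" "d r1 \<noteq> d r2"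
      "d r2 \<noteq> d r0" "\<not> C r2"
  shows False
proof -
  obtain v0 where v0: "v0 \<in> V" "\<not> P v0" "\<not> (C v0 \<and> c v0 = c r0)"
    "\<not> (D v0 \<and> d v0 = d r2)" "\<not> (E v0 \<and> e v0 = e r1)"
    by (rule avoid_right)
  obtain v1 where v1: "v1 \<in> V" "\<not> (C v1 \<and> (c v1 = c r0 \<or> c v1 = c v0))"
    "\<not> (D v1 \<and> (d v1 = d r1 \<or> d v1 = d r2))" "\<not> (E v1 \<and> (e v1 = e r0 \<or> e v1 = e r1))"
    by (rule avoid_pairs)
  obtain v2 where v2: "v2 \<in> V" "\<not> (C v2 \<and> (c v2 = c r0 \<or> c v2 = c v0))"
    "\<not> (D v2 \<and> (d v2 = d r1 \<or> d v2 = d r2))" "\<not> (E v2 \<and> (e v2 = e r1 \<or> e v2 = e v1))"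
    by (rule avoid_pairs)
  obtain v3 where v3: "v3 \<in> V" "\<not> P v3" "\<not> (C v3 \<and> c v3 = c r0)"
    "\<not> (D v3 \<and> d v3 = d r1)" "\<not> (E v3 \<and> e v3 = e r0)"
    by (rule avoid_right)
  obtain v4 where v4: "v4 \<in> V" "D r1 \<longrightarrow> P r1 \<noteq> P v4 \<and> d r1 = d v4 \<and> \<not> D v4
      \<and> \<not> (c r1 = c v4 \<and> (C r1 \<or> C v4)) \<and> \<not> (e r1 = e v4 \<and> (E r1 \<or> E v4))"
    by (rule witness_D[OF r1(1)])
  obtain v5 where v5: "v5 \<in> V" "\<not> P v5" "\<not> (C v5 \<and> c v5 = c r2)"
    "\<not> (D v5 \<and> d v5 = d r2)" "\<not> (E v5 \<and> e v5 = e r1)"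
    by (rule avoid_right)
  obtain v6 where v6: "v6 \<in> V" "E v5 \<longrightarrow> P v5 \<noteq> P v6 \<and> e v5 = e v6 \<and> \<not> E v6
      \<and> \<not> (c v5 = c v6 \<and> (C v5 \<or> C v6)) \<and> \<not> (d v5 = d v6 \<and> (D v5 \<or> D v6))"
    by (rule witness_E[OF v5(1)])
  obtain v7 where v7: "v7 \<in> V" "C v6 \<longrightarrow> P v6 \<noteq> P v7 \<and> c v6 = c v7 \<and> \<not> C v7
      \<and> \<not> (d v6 = d v7 \<and> (D v6 \<or> D v7)) \<and> \<not> (e v6 = e v7 \<and> (E v6 \<or> E v7))"
    by (rule witness_C[OF v6(1)])
  obtain v8 where v8: "v8 \<in> V" "\<not> (C v8 \<and> (c v8 = c r0 \<or> c v8 = c v6))"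
    "\<not> (D v8 \<and> (d v8 = d r0 \<or> d v8 = d r2))" "\<not> (E v8 \<and> (e v8 = e r0 \<or> e v8 = e r1))"
    by (rule avoid_pairs)
  obtain v9 where v9: "v9 \<in> V" "\<not> (C v9 \<and> (c v9 = c r0 \<or> c v9 = c v5))"
    "\<not> (D v9 \<and> (d v9 = d r0 \<or> d v9 = d r2))" "\<not> (E v9 \<and> (e v9 = e r0 \<or> e v9 = e r1))"
    by (rule avoid_pairs)
  obtain v10 where v10: "v10 \<in> V" "C v9 \<longrightarrow> P v9 \<noteq> P v10 \<and> c v9 = c v10 \<and> \<not> C v10
      \<and> \<not> (d v9 = d v10 \<and> (D v9 \<or> D v10)) \<and> \<not> (e v9 = e v10 \<and> (E v9 \<or> E v10))"
    by (rule witness_C[OF v9(1)])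
  obtain v11 where v11: "v11 \<in> V" "D v9 \<longrightarrow> P v9 \<noteq> P v11 \<and> d v9 = d v11 \<and> \<not> D v11
      \<and> \<not> (c v9 = c v11 \<and> (C v9 \<or> C v11)) \<and> \<not> (e v9 = e v11 \<and> (E v9 \<or> E v11))"
    by (rule witness_D[OF v9(1)])
  obtain v12 where v12: "v12 \<in> V" "\<not> P v12" "\<not> (C v12 \<and> c v12 = c v5)"
    "\<not> (D v12 \<and> d v12 = d r1)" "\<not> (E v12 \<and> e v12 = e v9)"
    by (rule avoid_right)
  obtain v13 where v13: "v13 \<in> V" "\<not> P v13" "\<not> (C v13 \<and> c v13 = c r2)"
    "\<not> (D v13 \<and> d v13 = d r1)" "\<not> (E v13 \<and> e v13 = e r0)"
    by (rule avoid_right)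
  obtain v14 where v14: "v14 \<in> V" "P v14" "\<not> (C v14 \<and> c v14 = c r0)"
    "\<not> (D v14 \<and> d v14 = d r2)" "\<not> (E v14 \<and> e v14 = e v9)"
    by (rule avoid_left)
  obtain v15 where v15: "v15 \<in> V" "\<not> (C v15 \<and> (c v15 = c r0 \<or> c v15 = c v5))"
    "\<not> (D v15 \<and> (d v15 = d r0 \<or> d v15 = d r2))" "\<not> (E v15 \<and> (e v15 = e r1 \<or> e v15 = e v9))"
    by (rule avoid_pairs)
  let ?vs = "[r0, r1, r2, v0, v1, v2, v3, v4, v5, v6, v7, v8, v9, v10, v11, v12, v13, v14, v15]"
  have in_V: "set ?vs \<subseteq> V"
    using r0(1) r1(1) r2(1) v0(1) v1(1) v2(1) v3(1) v4(1) v5(1) v6(1) v7(1) v8(1) v9(1) v10(1)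
      v11(1) v12(1) v13(1) v14(1) v15(1) by simp
  have "sorted_wrt (\<lambda>v w. P v = P w \<longrightarrow> alike v w) ?vs"
    by (rule sorted_wrt_on[OF _ in_V]) (use alike in blast)
  moreover have "sorted_wrt (\<lambda>v w. P v \<noteq> P w \<longrightarrow> monochrome v w) ?vs"
    by (rule sorted_wrt_on[OF _ in_V]) (use monochrome in blast)
  ultimately show False
    using chromatic_list[OF in_V] joined_list[OF in_V] r0 r1 r2 v0 v1 v2 v3 v4 v5 v6 v7 v8 v9 v10
      v11 v12 v13 v14 v15
    unfolding list.pred_inject sorted_wrt.simps list.set ball_simps
      chromatic_def joined_def alike_singles_def monochrome_singles_def
    by (smt (z3))
qed

lemma double_new_C:
  assumes alike: "\<And>v w. v \<in> V \<Longrightarrow> w \<in> V \<Longrightarrow> P v = P w \<Longrightarrow> alike v w"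
    and monochrome: "\<And>v w. v \<in> V \<Longrightarrow> w \<in> V \<Longrightarrow> P v \<noteq> P w \<Longrightarrow> monochrome v w"
    and r0: "r0 \<in> V" "P r0" "C r0" "\<not> D r0" "\<not> E r0"
    and r1: "r1 \<in> V" "\<not> P r1" "\<not> C r1" "D r1" "E r1" "c r0 = c r1" "d r0 \<noteq> d r1" "e r0 \<noteq> e r1"
    and r2: "r2 \<in> V" "P r2" "e r1 = e r2" "\<not> E r2" "\<not> (c r1 = c r2 \<and> C r2)" "d r1 \<noteq> d r2"
      "d r2 \<noteq> d r0" "C r2"
  shows False
proof -
  obtain v0 where v0: "v0 \<in> V" "\<not> P v0" "\<not> (C v0 \<and> c v0 = c r2)"
    "\<not> (D v0 \<and> d v0 = d r0)" "\<not> (E v0 \<and> e v0 = e r1)"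
    by (rule avoid_right)
  obtain v1 where v1: "v1 \<in> V" "\<not> (C v1 \<and> (c v1 = c r0 \<or> c v1 = c r2))"
    "\<not> (D v1 \<and> (d v1 = d r0 \<or> d v1 = d r1))" "\<not> (E v1 \<and> (e v1 = e r0 \<or> e v1 = e r1))"
    by (rule avoid_pairs)
  obtain v2 where v2: "v2 \<in> V" "\<not> (C v2 \<and> (c v2 = c r0 \<or> c v2 = c r2))"
    "\<not> (D v2 \<and> (d v2 = d r0 \<or> d v2 = d r1))" "\<not> (E v2 \<and> (e v2 = e r1 \<or> e v2 = e v0))"
    by (rule avoid_pairs)
  obtain v3 where v3: "v3 \<in> V" "\<not> (C v3 \<and> (c v3 = c r0 \<or> c v3 = c r2))"
    "\<not> (D v3 \<and> (d v3 = d r0 \<or> d v3 = d r1))" "\<not> (E v3 \<and> (e v3 = e v0 \<or> e v3 = e v2))"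
    by (rule avoid_pairs)
  obtain v4 where v4: "v4 \<in> V" "D r2 \<longrightarrow> P r2 \<noteq> P v4 \<and> d r2 = d v4 \<and> \<not> D v4
      \<and> \<not> (c r2 = c v4 \<and> (C r2 \<or> C v4)) \<and> \<not> (e r2 = e v4 \<and> (E r2 \<or> E v4))"
    by (rule witness_D[OF r2(1)])
  obtain v5 where v5: "v5 \<in> V" "C r2 \<longrightarrow> P r2 \<noteq> P v5 \<and> c r2 = c v5 \<and> \<not> C v5
      \<and> \<not> (d r2 = d v5 \<and> (D r2 \<or> D v5)) \<and> \<not> (e r2 = e v5 \<and> (E r2 \<or> E v5))"
    by (rule witness_C[OF r2(1)])
  obtain v6 where v6: "v6 \<in> V" "D v5 \<longrightarrow> P v5 \<noteq> P v6 \<and> d v5 = d v6 \<and> \<not> D v6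
      \<and> \<not> (c v5 = c v6 \<and> (C v5 \<or> C v6)) \<and> \<not> (e v5 = e v6 \<and> (E v5 \<or> E v6))"
    by (rule witness_D[OF v5(1)])
  obtain v7 where v7: "v7 \<in> V" "\<not> (C v7 \<and> (c v7 = c r0 \<or> c v7 = c r2))"
    "\<not> (D v7 \<and> (d v7 = d r0 \<or> d v7 = d r1))" "\<not> (E v7 \<and> (e v7 = e r0 \<or> e v7 = e v5))"
    by (rule avoid_pairs)
  obtain v8 where v8: "v8 \<in> V" "E v7 \<longrightarrow> P v7 \<noteq> P v8 \<and> e v7 = e v8 \<and> \<not> E v8
      \<and> \<not> (c v7 = c v8 \<and> (C v7 \<or> C v8)) \<and> \<not> (d v7 = d v8 \<and> (D v7 \<or> D v8))"
    by (rule witness_E[OF v7(1)])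
  obtain v9 where v9: "v9 \<in> V" "E v1 \<longrightarrow> P v1 \<noteq> P v9 \<and> e v1 = e v9 \<and> \<not> E v9
      \<and> \<not> (c v1 = c v9 \<and> (C v1 \<or> C v9)) \<and> \<not> (d v1 = d v9 \<and> (D v1 \<or> D v9))"
    by (rule witness_E[OF v1(1)])
  obtain v10 where v10: "v10 \<in> V" "D v9 \<longrightarrow> P v9 \<noteq> P v10 \<and> d v9 = d v10 \<and> \<not> D v10
      \<and> \<not> (c v9 = c v10 \<and> (C v9 \<or> C v10)) \<and> \<not> (e v9 = e v10 \<and> (E v9 \<or> E v10))"
    by (rule witness_D[OF v9(1)])
  obtain v11 where v11: "v11 \<in> V" "D v1 \<longrightarrow> P v1 \<noteq> P v11 \<and> d v1 = d v11 \<and> \<not> D v11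
      \<and> \<not> (c v1 = c v11 \<and> (C v1 \<or> C v11)) \<and> \<not> (e v1 = e v11 \<and> (E v1 \<or> E v11))"
    by (rule witness_D[OF v1(1)])
  let ?vs = "[r0, r1, r2, v0, v1, v2, v3, v4, v5, v6, v7, v8, v9, v10, v11]"
  have in_V: "set ?vs \<subseteq> V"
    using r0(1) r1(1) r2(1) v0(1) v1(1) v2(1) v3(1) v4(1) v5(1) v6(1) v7(1) v8(1) v9(1) v10(1)
      v11(1) by simp
  have "sorted_wrt (\<lambda>v w. P v = P w \<longrightarrow> alike v w) ?vs"
    by (rule sorted_wrt_on[OF _ in_V]) (use alike in blast)
  moreover have "sorted_wrt (\<lambda>v w. P v \<noteq> P w \<longrightarrow> monochrome v w) ?vs"
    by (rule sorted_wrt_on[OF _ in_V]) (use monochrome in blast)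
  ultimately show False
    using chromatic_list[OF in_V] joined_list[OF in_V] r0 r1 r2 v0 v1 v2 v3 v4 v5 v6 v7 v8 v9 v10
      v11
    unfolding list.pred_inject sorted_wrt.simps list.set ball_simps
      chromatic_def joined_def alike_singles_def monochrome_singles_def
    by (smt (z3))
qed

text \<open>Witnesses alone suffice: when every vertex lies in two covers, a witness for a colour
  misses exactly that colour and so has witnesses for the other two. Those followed from
  \<open>r0\<close> give nine vertices covered exactly twice, and the edges between the two sides
  cannot all be covered.\<close>

lemma no_singles:
  assumes double: "\<And>v. v \<in> V \<Longrightarrow> C v \<and> D v \<or> C v \<and> E v \<or> D v \<and> E v"
    and r0: "r0 \<in> V" "P r0" "C r0" "D r0" "\<not> E r0"
  shows False
proof -
  obtain v0 where v0: "v0 \<in> V" "C r0 \<longrightarrow> P r0 \<noteq> P v0 \<and> c r0 = c v0 \<and> \<not> C v0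
      \<and> \<not> (d r0 = d v0 \<and> (D r0 \<or> D v0)) \<and> \<not> (e r0 = e v0 \<and> (E r0 \<or> E v0))"
    by (rule witness_C[OF r0(1)])
  obtain v1 where v1: "v1 \<in> V" "D v0 \<longrightarrow> P v0 \<noteq> P v1 \<and> d v0 = d v1 \<and> \<not> D v1
      \<and> \<not> (c v0 = c v1 \<and> (C v0 \<or> C v1)) \<and> \<not> (e v0 = e v1 \<and> (E v0 \<or> E v1))"
    by (rule witness_D[OF v0(1)])
  obtain v2 where v2: "v2 \<in> V" "E v1 \<longrightarrow> P v1 \<noteq> P v2 \<and> e v1 = e v2 \<and> \<not> E v2
      \<and> \<not> (c v1 = c v2 \<and> (C v1 \<or> C v2)) \<and> \<not> (d v1 = d v2 \<and> (D v1 \<or> D v2))"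
    by (rule witness_E[OF v1(1)])
  obtain v3 where v3: "v3 \<in> V" "D v2 \<longrightarrow> P v2 \<noteq> P v3 \<and> d v2 = d v3 \<and> \<not> D v3
      \<and> \<not> (c v2 = c v3 \<and> (C v2 \<or> C v3)) \<and> \<not> (e v2 = e v3 \<and> (E v2 \<or> E v3))"
    by (rule witness_D[OF v2(1)])
  obtain v4 where v4: "v4 \<in> V" "E v0 \<longrightarrow> P v0 \<noteq> P v4 \<and> e v0 = e v4 \<and> \<not> E v4
      \<and> \<not> (c v0 = c v4 \<and> (C v0 \<or> C v4)) \<and> \<not> (d v0 = d v4 \<and> (D v0 \<or> D v4))"
    by (rule witness_E[OF v0(1)])
  obtain v5 where v5: "v5 \<in> V" "D v4 \<longrightarrow> P v4 \<noteq> P v5 \<and> d v4 = d v5 \<and> \<not> D v5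
      \<and> \<not> (c v4 = c v5 \<and> (C v4 \<or> C v5)) \<and> \<not> (e v4 = e v5 \<and> (E v4 \<or> E v5))"
    by (rule witness_D[OF v4(1)])
  obtain v6 where v6: "v6 \<in> V" "C v2 \<longrightarrow> P v2 \<noteq> P v6 \<and> c v2 = c v6 \<and> \<not> C v6
      \<and> \<not> (d v2 = d v6 \<and> (D v2 \<or> D v6)) \<and> \<not> (e v2 = e v6 \<and> (E v2 \<or> E v6))"
    by (rule witness_C[OF v2(1)])
  obtain v7 where v7: "v7 \<in> V" "E v3 \<longrightarrow> P v3 \<noteq> P v7 \<and> e v3 = e v7 \<and> \<not> E v7
      \<and> \<not> (c v3 = c v7 \<and> (C v3 \<or> C v7)) \<and> \<not> (d v3 = d v7 \<and> (D v3 \<or> D v7))"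
    by (rule witness_E[OF v3(1)])
  let ?vs = "[r0, v0, v1, v2, v3, v4, v5, v6, v7]"
  have in_V: "set ?vs \<subseteq> V"
    using r0(1) v0(1) v1(1) v2(1) v3(1) v4(1) v5(1) v6(1) v7(1) by simp
  have "list_all (\<lambda>v. C v \<and> D v \<or> C v \<and> E v \<or> D v \<and> E v) ?vs"
    using double in_V by simp
  then show False
    using chromatic_list[OF in_V] joined_list[OF in_V] r0 v0 v1 v2 v3 v4 v5 v6 v7
    unfolding list.pred_inject sorted_wrt.simps list.set ball_simps
      chromatic_def joined_def
    by (smt (z3))
qed

text \<open>Only the right side is assumed to be alike, as \<open>r0\<close> and \<open>r1\<close>
  violate this on the left. Together with its image under exchanging the second and third colours,
  this yields \<open>spread\<close> on the left.\<close>

lemma two_singles_aligned: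
  assumes alike: "\<And>v w. v \<in> V \<Longrightarrow> w \<in> V \<Longrightarrow> \<not> P v \<and> \<not> P w \<Longrightarrow> alike v w"
    and r0: "r0 \<in> V" "P r0" "C r0" "\<not> D r0" "\<not> E r0"
    and r1: "r1 \<in> V" "P r1" "C r1" "\<not> D r1" "\<not> E r1" "c r0 \<noteq> c r1" "e r0 = e r1"
  shows False
proof -
  obtain v0 where v0: "v0 \<in> V" "\<not> P v0" "\<not> (C v0 \<and> c v0 = c r0)"
    "\<not> (D v0 \<and> d v0 = d r0)" "\<not> (E v0 \<and> e v0 = e r0)"
    by (rule avoid_right)
  obtain v1 where v1: "v1 \<in> V" "\<not> P v1" "\<not> (C v1 \<and> c v1 = c r1)"
    "\<not> (D v1 \<and> d v1 = d r1)" "\<not> (E v1 \<and> e v1 = e r0)"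
    by (rule avoid_right)
  obtain v2 where v2: "v2 \<in> V" "\<not> (C v2 \<and> (c v2 = c r0 \<or> c v2 = c r1))"
    "\<not> (D v2 \<and> (d v2 = d r0 \<or> d v2 = d r1))" "\<not> (E v2 \<and> (e v2 = e r0 \<or> e v2 = e v1))"
    by (rule avoid_pairs)
  \<comment> \<open>Under the split 1 + 2 a left vertex avoids every listed component, while a right
    vertex may be covered in one component listed once. A component listed twice is forbidden on
    both sides.\<close>
  obtain v3 where v3: "v3 \<in> V"
    "light 1 2 [c r0, c r1, c v2] [d r0, d r1, d r1] [e r0, e r0, e v1] v3"
    by (rule light_vertex_equal[of "[c r0, c r1, c v2]" 1 2 "[d r0, d r1, d r1]"
      "[e r0, e r0, e v1]"]) simp_all
  obtain v4 where v4: "v4 \<in> V" "\<not> (C v4 \<and> (c v4 = c r0 \<or> c v4 = c r1))"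
    "\<not> (D v4 \<and> (d v4 = d r0 \<or> d v4 = d r1))" "\<not> (E v4 \<and> (e v4 = e r0 \<or> e v4 = e v0))"
    by (rule avoid_pairs)
  obtain v5 where v5: "v5 \<in> V" "\<not> P v5" "\<not> (C v5 \<and> c v5 = c v4)"
    "\<not> (D v5 \<and> d v5 = d v4)" "\<not> (E v5 \<and> e v5 = e v0)"
    by (rule avoid_right)
  obtain v6 where v6: "v6 \<in> V"
    "light 1 2 [c r0, c r1, c v4] [d r0, d r1, d v4] [e r0, e r0, e v0] v6"
    by (rule light_vertex_equal[of "[c r0, c r1, c v4]" 1 2 "[d r0, d r1, d v4]"
      "[e r0, e r0, e v0]"]) simp_all
  obtain v7 where v7: "v7 \<in> V"
    "light 1 2 [c r0, c r1, c v4] [d r0, d r1, d v5] [e r0, e r0, e v0] v7"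
    by (rule light_vertex_equal[of "[c r0, c r1, c v4]" 1 2 "[d r0, d r1, d v5]"
      "[e r0, e r0, e v0]"]) simp_all
  obtain v8 where v8: "v8 \<in> V" "\<not> P v8" "\<not> (C v8 \<and> c v8 = c v7)"
    "\<not> (D v8 \<and> d v8 = d v5)" "\<not> (E v8 \<and> e v8 = e v0)"
    by (rule avoid_right)
  obtain v9 where v9: "v9 \<in> V" "\<not> (C v9 \<and> (c v9 = c r0 \<or> c v9 = c r1))"
    "\<not> (D v9 \<and> (d v9 = d v4 \<or> d v9 = d v6))" "\<not> (E v9 \<and> (e v9 = e r0 \<or> e v9 = e v0))"
    by (rule avoid_pairs)
  obtain v10 where v10: "v10 \<in> V"
    "light 1 2 [c r0, c r1, c v5] [d r0, d r1, d v4] [e r0, e r0, e v0] v10"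
    by (rule light_vertex_equal[of "[c r0, c r1, c v5]" 1 2 "[d r0, d r1, d v4]"
      "[e r0, e r0, e v0]"]) simp_all
  obtain v11 where v11: "v11 \<in> V" "\<not> P v11" "\<not> (C v11 \<and> c v11 = c v5)"
    "\<not> (D v11 \<and> d v11 = d v10)" "\<not> (E v11 \<and> e v11 = e v0)"
    by (rule avoid_right)
  obtain v12 where v12: "v12 \<in> V"
    "light 1 3 [c r0, c r1, c v4, c v7] [d r0, d r0, d r1, d r1] [e r0, e r0, e r0, e v0] v12"
    by (rule light_vertex_equal[of "[c r0, c r1, c v4, c v7]" 1 3 "[d r0, d r0, d r1, d r1]"
      "[e r0, e r0, e r0, e v0]"]) simp_all
  obtain v13 where v13: "v13 \<in> V" "\<not> (C v13 \<and> (c v13 = c r0 \<or> c v13 = c r1))"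
    "\<not> (D v13 \<and> (d v13 = d r0 \<or> d v13 = d r1))" "\<not> (E v13 \<and> (e v13 = e v0 \<or> e v13 = e v1))"
    by (rule avoid_pairs)
  obtain v14 where v14: "v14 \<in> V"
    "light 1 2 [c r0, c r1, c v2] [d r0, d r0, d r1] [e r0, e v0, e v1] v14"
    by (rule light_vertex_equal[of "[c r0, c r1, c v2]" 1 2 "[d r0, d r0, d r1]"
      "[e r0, e v0, e v1]"]) simp_all
  obtain v15 where v15: "v15 \<in> V"
    "light 1 2 [c r0, c r1, c v2] [d r0, d r0, d r1] [e r0, e r0, e v0] v15"
    by (rule light_vertex_equal[of "[c r0, c r1, c v2]" 1 2 "[d r0, d r0, d r1]"
      "[e r0, e r0, e v0]"]) simp_all
  obtain v16 where v16: "v16 \<in> V"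
    "light 1 2 [c r0, c r1, c v13] [d r0, d r1, d r1] [e r0, e v0, e v1] v16"
    by (rule light_vertex_equal[of "[c r0, c r1, c v13]" 1 2 "[d r0, d r1, d r1]"
      "[e r0, e v0, e v1]"]) simp_all
  obtain v17 where v17: "v17 \<in> V" "\<not> P v17" "\<not> (C v17 \<and> c v17 = c v14)"
    "\<not> (D v17 \<and> d v17 = d r1)" "\<not> (E v17 \<and> e v17 = e v1)"
    by (rule avoid_right)
  obtain v18 where v18: "v18 \<in> V"
    "light 1 3 [c r0, c r1, c v2, c v14] [d r0, d r0, d r1, d r1] [e r0, e v0, e v1, e v1] v18"
    by (rule light_vertex_equal[of "[c r0, c r1, c v2, c v14]" 1 3 "[d r0, d r0, d r1, d r1]"
      "[e r0, e v0, e v1, e v1]"]) simp_all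
  let ?vs = "[r0, r1, v0, v1, v2, v3, v4, v5, v6, v7, v8, v9, v10, v11, v12, v13, v14, v15, v16,
    v17, v18]"
  have in_V: "set ?vs \<subseteq> V"
    using r0(1) r1(1) v0(1) v1(1) v2(1) v3(1) v4(1) v5(1) v6(1) v7(1) v8(1) v9(1) v10(1) v11(1)
      v12(1) v13(1) v14(1) v15(1) v16(1) v17(1) v18(1) by simp
  have "sorted_wrt (\<lambda>v w. \<not> P v \<and> \<not> P w \<longrightarrow> alike v w) ?vs"
    by (rule sorted_wrt_on[OF _ in_V]) (use alike in blast)
  then show False
    using chromatic_list[OF in_V] joined_list[OF in_V] r0 r1 v0 v1 v2 v3 v4 v5 v6 v7 v8 v9 v10 v11
      v12 v13 v14 v15 v16 v17 v18
    unfolding list.pred_inject sorted_wrt.simps list.set ball_simps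
      chromatic_def joined_def alike_singles_def light_1_1 light_1_2 light_1_3
      two_le_weight_3 two_le_weight_4 three_le_weight_4 insert_iff empty_iff
    by (smt (z3))
qed

text \<open>By \<open>spread\<close> the labels of \<open>r0\<close>, \<open>r1\<close>,
  \<open>r2\<close> are distinct in every colour. \<open>v0\<close> agrees with \<open>r0\<close> in
  \<open>c\<close>, so it reaches \<open>r1\<close> and \<open>r2\<close> only by lying in both
  \<open>D\<close> and \<open>E\<close> with their labels; similarly for \<open>v1\<close> and
  \<open>v2\<close>. On the right, \<open>v3\<close> would need weight 2 to be joined to all three
  singles. So it is on the left and avoids all nine components. Being joined to \<open>v0\<close>,
  \<open>v1\<close>, \<open>v2\<close>, it shares a label \<open>d\<close> and a label
  \<open>e\<close> with singles, hence is covered by \<open>C\<close> only, in a fourth component,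
  against \<open>spread\<close>.\<close>

lemma three_singles:
  assumes alike: "\<And>v w. v \<in> V \<Longrightarrow> w \<in> V \<Longrightarrow> \<not> P v \<and> \<not> P w \<Longrightarrow> alike v w"
    and spread: "\<And>v w. v \<in> V \<Longrightarrow> w \<in> V \<Longrightarrow> P v \<and> P w \<Longrightarrow> spread v w"
    and r0: "r0 \<in> V" "P r0" "C r0" "\<not> D r0" "\<not> E r0"
    and r1: "r1 \<in> V" "P r1" "C r1" "\<not> D r1" "\<not> E r1"
    and r2: "r2 \<in> V" "P r2" "C r2" "\<not> D r2" "\<not> E r2" "c r0 \<noteq> c r1" "c r0 \<noteq> c r2" "c r1 \<noteq> c r2"
  shows False
proof -
  obtain v0 where v0: "v0 \<in> V" "\<not> P v0" "\<not> (C v0 \<and> c v0 = c r0)"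
    "\<not> (D v0 \<and> d v0 = d r0)" "\<not> (E v0 \<and> e v0 = e r0)"
    by (rule avoid_right)
  obtain v1 where v1: "v1 \<in> V" "\<not> P v1" "\<not> (C v1 \<and> c v1 = c r1)"
    "\<not> (D v1 \<and> d v1 = d r1)" "\<not> (E v1 \<and> e v1 = e r1)"
    by (rule avoid_right)
  obtain v2 where v2: "v2 \<in> V" "\<not> P v2" "\<not> (C v2 \<and> c v2 = c r2)"
    "\<not> (D v2 \<and> d v2 = d r2)" "\<not> (E v2 \<and> e v2 = e r2)"
    by (rule avoid_right)
  obtain v3 where v3: "v3 \<in> V"
    "light 1 2 [c r0, c r1, c r2] [d r0, d r1, d r2] [e r0, e r1, e r2] v3"
    by (rule light_vertex_equal[of "[c r0, c r1, c r2]" 1 2 "[d r0, d r1, d r2]"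
      "[e r0, e r1, e r2]"]) simp_all
  let ?vs = "[r0, r1, r2, v0, v1, v2, v3]"
  have in_V: "set ?vs \<subseteq> V"
    using r0(1) r1(1) r2(1) v0(1) v1(1) v2(1) v3(1) by simp
  have "sorted_wrt (\<lambda>v w. \<not> P v \<and> \<not> P w \<longrightarrow> alike v w) ?vs"
    by (rule sorted_wrt_on[OF _ in_V]) (use alike in blast)
  moreover have "sorted_wrt (\<lambda>v w. P v \<and> P w \<longrightarrow> spread v w) ?vs"
    by (rule sorted_wrt_on[OF _ in_V]) (use spread in blast)
  ultimately show False
    using chromatic_list[OF in_V] joined_list[OF in_V] r0 r1 r2 v0 v1 v2 v3
    unfolding list.pred_inject sorted_wrt.simps list.set ball_simps
      chromatic_def joined_def alike_singles_def light_1_1 light_1_2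
      two_le_weight_3 insert_iff empty_iff spread_singles_def
    by (smt (z3))
qed

text \<open>\<open>two\<close> records that a third component is already excluded. \<open>r2\<close>
  avoids the components of \<open>r1\<close>, so its edge to \<open>r0\<close> is covered by
  \<open>r2\<close> in the second or third colour; up to exchanging these it is the second.\<close>

lemma two_singles_covered:
  assumes alike: "\<And>v w. v \<in> V \<Longrightarrow> w \<in> V \<Longrightarrow> \<not> P v \<and> \<not> P w \<Longrightarrow> alike v w"
    and spread: "\<And>v w. v \<in> V \<Longrightarrow> w \<in> V \<Longrightarrow> P v \<and> P w \<Longrightarrow> spread v w"
    and two: "\<And>v. v \<in> V \<Longrightarrow> P v \<Longrightarrow> \<not> D v \<Longrightarrow> \<not> E v \<Longrightarrow> c v = c r0 \<or> c v = c r1"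
    and r0: "r0 \<in> V" "P r0" "C r0" "\<not> D r0" "\<not> E r0"
    and r1: "r1 \<in> V" "P r1" "C r1" "\<not> D r1" "\<not> E r1" "c r0 \<noteq> c r1"
    and r2: "r2 \<in> V" "\<not> P r2" "\<not> (C r2 \<and> c r2 = c r1)" "\<not> (D r2 \<and> d r2 = d r1)" "\<not> (E r2 \<and> e r2 = e
      r1)"
      "D r2" "d r2 = d r0"
  shows False
proof -
  obtain v0 where v0: "v0 \<in> V" "\<not> P v0" "\<not> (C v0 \<and> c v0 = c r0)"
    "\<not> (D v0 \<and> d v0 = d r0)" "\<not> (E v0 \<and> e v0 = e r0)"
    by (rule avoid_right)
  obtain v1 where v1: "v1 \<in> V" "\<not> (C v1 \<and> (c v1 = c r0 \<or> c v1 = c r1))"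
    "\<not> (D v1 \<and> (d v1 = d r0 \<or> d v1 = d r1))" "\<not> (E v1 \<and> (e v1 = e r1 \<or> e v1 = e r2))"
    by (rule avoid_pairs)
  obtain v2 where v2: "v2 \<in> V" "\<not> (C v2 \<and> (c v2 = c r0 \<or> c v2 = c r1))"
    "\<not> (D v2 \<and> (d v2 = d r0 \<or> d v2 = d r1))" "\<not> (E v2 \<and> (e v2 = e r2 \<or> e v2 = e v0))"
    by (rule avoid_pairs)
  obtain v3 where v3: "v3 \<in> V" "\<not> (C v3 \<and> (c v3 = c r0 \<or> c v3 = c r1))"
    "\<not> (D v3 \<and> (d v3 = d r0 \<or> d v3 = d v1))" "\<not> (E v3 \<and> (e v3 = e r0 \<or> e v3 = e r2))"
    by (rule avoid_pairs)
  obtain v4 where v4: "v4 \<in> V" "D v1 \<longrightarrow> P v1 \<noteq> P v4 \<and> d v1 = d v4 \<and> \<not> D v4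
      \<and> \<not> (c v1 = c v4 \<and> (C v1 \<or> C v4)) \<and> \<not> (e v1 = e v4 \<and> (E v1 \<or> E v4))"
    by (rule witness_D[OF v1(1)])
  obtain v5 where v5: "v5 \<in> V" "\<not> (C v5 \<and> (c v5 = c r0 \<or> c v5 = c r1))"
    "\<not> (D v5 \<and> (d v5 = d r0 \<or> d v5 = d v1))" "\<not> (E v5 \<and> (e v5 = e r1 \<or> e v5 = e r2))"
    by (rule avoid_pairs)
  obtain v6 where v6: "v6 \<in> V" "\<not> (C v6 \<and> (c v6 = c r0 \<or> c v6 = c r1))"
    "\<not> (D v6 \<and> (d v6 = d r1 \<or> d v6 = d v1))" "\<not> (E v6 \<and> (e v6 = e r1 \<or> e v6 = e r2))"
    by (rule avoid_pairs)
  obtain v7 where v7: "v7 \<in> V" "C v1 \<longrightarrow> P v1 \<noteq> P v7 \<and> c v1 = c v7 \<and> \<not> C v7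
      \<and> \<not> (d v1 = d v7 \<and> (D v1 \<or> D v7)) \<and> \<not> (e v1 = e v7 \<and> (E v1 \<or> E v7))"
    by (rule witness_C[OF v1(1)])
  obtain v8 where v8: "v8 \<in> V" "E r2 \<longrightarrow> P r2 \<noteq> P v8 \<and> e r2 = e v8 \<and> \<not> E v8
      \<and> \<not> (c r2 = c v8 \<and> (C r2 \<or> C v8)) \<and> \<not> (d r2 = d v8 \<and> (D r2 \<or> D v8))"
    by (rule witness_E[OF r2(1)])
  obtain v9 where v9: "v9 \<in> V" "\<not> (C v9 \<and> (c v9 = c r0 \<or> c v9 = c r1))"
    "\<not> (D v9 \<and> (d v9 = d r1 \<or> d v9 = d v1))" "\<not> (E v9 \<and> (e v9 = e r0 \<or> e v9 = e r2))"
    by (rule avoid_pairs)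
  obtain v10 where v10: "v10 \<in> V" "\<not> (C v10 \<and> (c v10 = c r0 \<or> c v10 = c r1))"
    "\<not> (D v10 \<and> (d v10 = d r1 \<or> d v10 = d r2))" "\<not> (E v10 \<and> (e v10 = e r0 \<or> e v10 = e r1))"
    by (rule avoid_pairs)
  obtain v11 where v11: "v11 \<in> V" "\<not> (C v11 \<and> (c v11 = c r0 \<or> c v11 = c r1))"
    "\<not> (D v11 \<and> (d v11 = d r2 \<or> d v11 = d v10))" "\<not> (E v11 \<and> (e v11 = e r0 \<or> e v11 = e r1))"
    by (rule avoid_pairs)
  let ?vs = "[r0, r1, r2, v0, v1, v2, v3, v4, v5, v6, v7, v8, v9, v10, v11]"
  have in_V: "set ?vs \<subseteq> V"
    using r0(1) r1(1) r2(1) v0(1) v1(1) v2(1) v3(1) v4(1) v5(1) v6(1) v7(1) v8(1) v9(1) v10(1)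
      v11(1) by simp
  have "sorted_wrt (\<lambda>v w. \<not> P v \<and> \<not> P w \<longrightarrow> alike v w) ?vs"
    by (rule sorted_wrt_on[OF _ in_V]) (use alike in blast)
  moreover have "sorted_wrt (\<lambda>v w. P v \<and> P w \<longrightarrow> spread v w) ?vs"
    by (rule sorted_wrt_on[OF _ in_V]) (use spread in blast)
  moreover have "list_all (\<lambda>v. P v \<and> \<not> D v \<and> \<not> E v \<longrightarrow> c v = c r0 \<or> c v = c r1) ?vs"
    using two in_V by simp
  ultimately show False
    using chromatic_list[OF in_V] joined_list[OF in_V] r0 r1 r2 v0 v1 v2 v3 v4 v5 v6 v7 v8 v9 v10
      v11
    unfolding list.pred_inject sorted_wrt.simps list.set ball_simps
      chromatic_def joined_def alike_singles_def spread_singles_def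
    by (smt (z3))
qed

subsection \<open>The surviving configuration\<close>

lemma bound_by_covers:
  assumes "\<And>v. v \<in> V \<Longrightarrow> q v \<Longrightarrow> X v \<and> (x v = i \<or> x v = j) \<or> Y v \<and> (y v = k \<or> y v = l)"
    and "\<And>i. card {v \<in> V. X v \<and> x v = i} \<le> a" "\<And>i. card {v \<in> V. Y v \<and> y v = i} \<le> b"
    and "card {v \<in> V. q v} = n"
  shows "n \<le> 2 * a + (if k = l then b else 2 * b)"
proof -
  have "n \<le> card (({v \<in> V. X v \<and> x v = i} \<union> {v \<in> V. X v \<and> x v = j})
      \<union> ({v \<in> V. Y v \<and> y v = k} \<union> {v \<in> V. Y v \<and> y v = l}))"
    unfolding assms(4)[symmetric] by (rule card_mono) (use finite_V assms(1) in auto)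
  also have "\<dots> \<le> (card {v \<in> V. X v \<and> x v = i} + card {v \<in> V. X v \<and> x v = j})
      + card ({v \<in> V. Y v \<and> y v = k} \<union> {v \<in> V. Y v \<and> y v = l})"
    by (intro order.trans[OF card_Un_le] add_mono card_Un_le order.refl)
  also have "card ({v \<in> V. Y v \<and> y v = k} \<union> {v \<in> V. Y v \<and> y v = l}) \<le> (if k = l then b else 2 * b)"
    using assms(3)[of k] assms(3)[of l] card_Un_le[of "{v \<in> V. Y v \<and> y v = k}" "{v \<in> V. Y v \<and> y v =
      l}"]
    by auto
  finally show ?thesis
    using assms(2)[of i] assms(2)[of j] by linarith
qed

text \<open>The four edges between the singles agree in \<open>c\<close> or \<open>d\<close>, which
  puts \<open>d r0\<close>, \<open>d r1\<close> among \<open>d r2\<close>, \<open>d r3\<close> and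
  \<open>c r2\<close>, \<open>c r3\<close> among \<open>c r0\<close>, \<open>c r1\<close>. If both
  equations failed, \<open>v0\<close> would be a left vertex covered by \<open>E\<close> in the
  component of \<open>r2\<close> or \<open>r3\<close>, \<open>v1\<close> a right vertex covered by
  \<open>E\<close> in that of \<open>r0\<close> or \<open>r1\<close>, and no colour could cover the
  edge between them.\<close>

lemma mixed_labels:
  assumes r0: "r0 \<in> V" "P r0" "C r0" "\<not> D r0" "\<not> E r0"
    and r1: "r1 \<in> V" "P r1" "C r1" "\<not> D r1" "\<not> E r1" "c r0 \<noteq> c r1"
    and r2: "r2 \<in> V" "\<not> P r2" "\<not> C r2" "D r2" "\<not> E r2"
    and r3: "r3 \<in> V" "\<not> P r3" "\<not> C r3" "D r3" "\<not> E r3" "d r2 \<noteq> d r3"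
  shows "e r0 = e r1 \<or> e r2 = e r3"
proof (rule ccontr)
  assume neq: "\<not> ?thesis"
  obtain v0 where v0: "v0 \<in> V" "\<not> (C v0 \<and> (c v0 = c r0 \<or> c v0 = c r1))"
    "\<not> (D v0 \<and> (d v0 = d r2 \<or> d v0 = d r3))" "\<not> (E v0 \<and> (e v0 = e r0 \<or> e v0 = e r1))"
    by (rule avoid_pairs)
  obtain v1 where v1: "v1 \<in> V" "\<not> (C v1 \<and> (c v1 = c r0 \<or> c v1 = c r1))"
    "\<not> (D v1 \<and> (d v1 = d r2 \<or> d v1 = d r3))" "\<not> (E v1 \<and> (e v1 = e r2 \<or> e v1 = e r3))"
    by (rule avoid_pairs)
  let ?vs = "[r0, r1, r2, r3, v0, v1]"
  have in_V: "set ?vs \<subseteq> V"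
    using r0(1) r1(1) r2(1) r3(1) v0(1) v1(1) by simp
  show False
    using chromatic_list[OF in_V] joined_list[OF in_V] neq r0 r1 r2 r3 v0 v1
    unfolding list.pred_inject sorted_wrt.simps list.set ball_simps chromatic_def joined_def
    by (smt (z3))
qed

text \<open>As \<open>c r0 \<noteq> c r1\<close>, a right vertex agrees with \<open>r0\<close> or
  \<open>r1\<close> in \<open>d\<close> or \<open>e\<close>, where only the right vertex can be the
  covering end; by \<open>eq\<close> this leaves three components. Symmetrically, four components
  cover the left side. The bound with \<open>s\<close> in place of \<open>u\<close> exchanges the
  third component on the right for one of the first colour.\<close>

lemma mixed_bound:
  assumes r0: "r0 \<in> V" "P r0" "C r0" "\<not> D r0" "\<not> E r0"
    and r1: "r1 \<in> V" "P r1" "C r1" "\<not> D r1" "\<not> E r1" "c r0 \<noteq> c r1"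
    and r2: "r2 \<in> V" "\<not> P r2" "\<not> C r2" "D r2" "\<not> E r2"
    and r3: "r3 \<in> V" "\<not> P r3" "\<not> C r3" "D r3" "\<not> E r3" "d r2 \<noteq> d r3"
    and eq: "e r0 = e r1"
  shows "n \<le> 2 * t + min s u \<and> n \<le> 2 * (s + u)"
proof -
  have right: "D v \<and> (d v = d r2 \<or> d v = d r3) \<or> E v \<and> e v = e r0" if v: "v \<in> V" "\<not> P v" for v
  proof -
    have in_V: "set [r0, r1, r2, r3, v] \<subseteq> V"
      using r0(1) r1(1) r2(1) r3(1) v(1) by simp
    show ?thesis
      using chromatic_list[OF in_V] joined_list[OF in_V] eq r0 r1 r2 r3 v
      unfolding list.pred_inject sorted_wrt.simps list.set ball_simps chromatic_def joined_def
      by (smt (z3))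
  qed
  have left: "C v \<and> (c v = c r0 \<or> c v = c r1) \<or> E v \<and> (e v = e r2 \<or> e v = e r3)"
    if v: "v \<in> V" "P v" for v
  proof -
    have in_V: "set [r0, r1, r2, r3, v] \<subseteq> V"
      using r0(1) r1(1) r2(1) r3(1) v(1) by simp
    show ?thesis
      using chromatic_list[OF in_V] joined_list[OF in_V] eq r0 r1 r2 r3 v
      unfolding list.pred_inject sorted_wrt.simps list.set ball_simps chromatic_def joined_def
      by (smt (z3))
  qed
  have right_bound: "n \<le> 2 * t + u"
    using bound_by_covers[where q = "\<lambda>v. \<not> P v" and X = D and x = d and Y = E and y = e
        and i = "d r2" and j = "d r3" and k = "e r0" and l = "e r0", OF _ cap_D cap_E card_right]
          right
    by simp
  have left_bound: "n \<le> 2 * s + 2 * u"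
    using bound_by_covers[where q = P and X = C and x = c and Y = E and y = e
        and i = "c r0" and j = "c r1" and k = "e r2" and l = "e r3", OF _ cap_C cap_E card_left]
          left
    by (simp split: if_splits)
  have "n \<le> 2 * t + s" if "s < u"
  proof -
    \<comment> \<open>Trading one component of the third colour for one of the first is affordable
      as \<open>s < u\<close>: the total \<open>3 * s + 2 * t + u\<close> stays below
      \<open>2 * (s + t + u)\<close>.\<close>
    have heavy: "length [i, j, k] * s + length [i', j'] * t + length [k'] * u < (1 + 1) * n"
      for i j k i' j' k' :: 'l
      using that large by simp
    \<comment> \<open>A left vertex covered by \<open>E\<close> only, in a component other than
      \<open>e r0\<close>, forces the right vertices that rely on \<open>e r0\<close> to agree with
      it in another colour and to be the covering end there.\<close>
    have "\<exists>r4\<in>V. P r4 \<and> \<not> C r4 \<and> \<not> D r4 \<and> e r4 \<noteq> e r0"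
    proof (rule ccontr)
      assume single: "\<not> ?thesis"
      obtain v0 where v0: "v0 \<in> V" "\<not> (C v0 \<and> (c v0 = c r0 \<or> c v0 = c r1))"
        "\<not> (D v0 \<and> (d v0 = d r2 \<or> d v0 = d r3))" "\<not> (E v0 \<and> (e v0 = e r2 \<or> e v0 = e r3))"
        by (rule avoid_pairs)
      obtain v1 where v1: "v1 \<in> V" "\<not> (C v1 \<and> (c v1 = c r0 \<or> c v1 = c r1))"
        "\<not> (D v1 \<and> (d v1 = d r2 \<or> d v1 = d r3))" "\<not> (E v1 \<and> (e v1 = e r0 \<or> e v1 = e r2))"
        by (rule avoid_pairs)
      obtain v2 where v2: "v2 \<in> V" "\<not> (C v2 \<and> (c v2 = c r0 \<or> c v2 = c r1))"
        "\<not> (D v2 \<and> (d v2 = d r2 \<or> d v2 = d r3))" "\<not> (E v2 \<and> (e v2 = e r0 \<or> e v2 = e v0))"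
        by (rule avoid_pairs)
      obtain v3 where v3: "v3 \<in> V"
    "light 1 1 [c r0, c r1, c v2] [d r2, d r3] [e r0] v3"
        by (rule light_vertex[OF heavy])
      let ?vs = "[r0, r1, r2, r3, v0, v1, v2, v3]"
      have in_V: "set ?vs \<subseteq> V"
        using r0(1) r1(1) r2(1) r3(1) v0(1) v1(1) v2(1) v3(1) by simp
      have "list_all (\<lambda>v. P v \<and> \<not> C v \<and> \<not> D v \<longrightarrow> e v = e r0) ?vs"
        using single in_V by auto
      then show False
        using chromatic_list[OF in_V] joined_list[OF in_V] eq r0 r1 r2 r3 v0 v1 v2 v3
        unfolding list.pred_inject sorted_wrt.simps list.set ball_simps chromatic_def joined_def
          light_1_1 insert_iff empty_iff
        by (smt (z3))
    qed
    then obtain r4 where r4: "r4 \<in> V" "P r4" "\<not> C r4" "\<not> D r4" "e r4 \<noteq> e r0"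
      by blast
    \<comment> \<open>\<open>v0\<close> must be a left vertex covered by \<open>E\<close> in the
      component of \<open>r3\<close>, which shows \<open>e r2 \<noteq> e r3\<close>. Hence
      \<open>r4\<close> agrees with \<open>r2\<close> or \<open>r3\<close> in \<open>d\<close>, and
      no further component of the second colour is needed.\<close>
    obtain v0 where v0: "v0 \<in> V" "\<not> (C v0 \<and> (c v0 = c r0 \<or> c v0 = c r1))"
      "\<not> (D v0 \<and> (d v0 = d r2 \<or> d v0 = d r3))" "\<not> (E v0 \<and> (e v0 = e r0 \<or> e v0 = e r2))"
      by (rule avoid_pairs)
    have "D v \<and> (d v = d r2 \<or> d v = d r3) \<or> C v \<and> c v = c r4" if v: "v \<in> V" "\<not> P v" for v
    proof -
      have in_V: "set [r0, r1, r2, r3, r4, v0, v] \<subseteq> V"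
        using r0(1) r1(1) r2(1) r3(1) r4(1) v0(1) v(1) by simp
      show ?thesis
        using chromatic_list[OF in_V] joined_list[OF in_V] eq r0 r1 r2 r3 r4 v0 v
        unfolding list.pred_inject sorted_wrt.simps list.set ball_simps chromatic_def joined_def
        by (smt (z3))
    qed
    then show ?thesis
      using bound_by_covers[where q = "\<lambda>v. \<not> P v" and X = D and x = d and Y = C and y = c
          and i = "d r2" and j = "d r3" and k = "c r4" and l = "c r4", OF _ cap_D cap_C card_right]
      by simp
  qed
  then show ?thesis
    using right_bound left_bound by (cases "s < u") auto
qed

lemma mixed:
  assumes "several V P c D E" "several V (\<lambda>v. \<not> P v) d C E"
  shows "n \<le> 2 * t + min s u \<and> n \<le> 2 * (s + u) \<or> n \<le> 2 * s + min t u \<and> n \<le> 2 * (t + u)"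
proof -
  obtain r0 r1 where r0: "r0 \<in> V" "P r0" "C r0" "\<not> D r0" "\<not> E r0"
    and r1: "r1 \<in> V" "P r1" "C r1" "\<not> D r1" "\<not> E r1" "c r0 \<noteq> c r1"
    using assms(1) coloured unfolding several_def by metis
  obtain r2 r3 where r2: "r2 \<in> V" "\<not> P r2" "\<not> C r2" "D r2" "\<not> E r2"
    and r3: "r3 \<in> V" "\<not> P r3" "\<not> C r3" "D r3" "\<not> E r3" "d r2 \<noteq> d r3"
    using assms(2) coloured unfolding several_def by metis
  interpret flipped: cover_system V "\<lambda>v. \<not> P v" d c e D C E t s u n
    by (rule cover_system.swap_CD[OF flip_sides])
  from mixed_labels[OF r0 r1 r2 r3] show ?thesis
  proof
    assume "e r0 = e r1"
    then show ?thesis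
      using mixed_bound[OF r0 r1 r2 r3] by blast
  next
    assume eq: "e r2 = e r3"
    have "n \<le> 2 * s + min t u \<and> n \<le> 2 * (t + u)"
      by (rule flipped.mixed_bound[of r2 r3 r0 r1]) (use r0 r1 r2 r3 eq in simp_all)
    then show ?thesis ..
  qed
qed

subsection \<open>Excluding the other configurations\<close>

lemma spread_C:
  assumes alike: "\<And>v w. v \<in> V \<Longrightarrow> w \<in> V \<Longrightarrow> \<not> P v \<and> \<not> P w \<Longrightarrow> alike v w"
    and v: "v \<in> V" "P v" "\<not> D v" "\<not> E v" and w: "w \<in> V" "P w" "\<not> D w" "\<not> E w" and neq: "c v \<noteq> c w"
  shows "d v \<noteq> d w \<and> e v \<noteq> e w"
proof -
  interpret Y: cover_system V P c e d C E D s u t n by (rule swap_DE)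
  have alike': "Y.alike v w" if "v \<in> V" "w \<in> V" "\<not> P v \<and> \<not> P w" for v w
    using alike[OF that] by (auto simp: alike_singles_def)
  have C: "C v" "C w"
    using v w coloured by auto
  show ?thesis
  proof (intro conjI notI)
    assume eq: "e v = e w"
    show False
      by (rule two_singles_aligned[of v w]) (fact alike v w C neq eq)+
  next
    assume eq: "d v = d w"
    show False
      by (rule Y.two_singles_aligned[of v w]) (fact alike' v w C neq eq)+
  qed
qed

lemma spread_if_right_alike:
  assumes alike: "\<And>v w. v \<in> V \<Longrightarrow> w \<in> V \<Longrightarrow> \<not> P v \<and> \<not> P w \<Longrightarrow> alike v w"
    and "v \<in> V" "w \<in> V" "P v \<and> P w"
  shows "spread v w"
proof -
  interpret X: cover_system V P d c e D C E t s u n by (rule swap_CD)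
  interpret Y: cover_system V P e c d E C D u s t n by (rule cover_system.swap_CD[OF swap_DE])
  have X: "X.alike v w" and Y: "Y.alike v w" if "v \<in> V" "w \<in> V" "\<not> P v \<and> \<not> P w" for v w
    using alike[OF that] by (auto simp: alike_singles_def)
  have P: "P v" "P w"
    using assms(4) by auto
  show ?thesis
    unfolding spread_singles_def
    using spread_C[of v w] X.spread_C[of v w] Y.spread_C[of v w] alike X Y assms(2,3) P by metis
qed

lemma one_sided:
  assumes alike: "\<And>v w. v \<in> V \<Longrightarrow> w \<in> V \<Longrightarrow> \<not> P v \<and> \<not> P w \<Longrightarrow> alike v w"
    and "several V P c D E"
  shows False
proof -
  obtain r0 r1 where r0: "r0 \<in> V" "P r0" "C r0" "\<not> D r0" "\<not> E r0"
    and r1: "r1 \<in> V" "P r1" "C r1" "\<not> D r1" "\<not> E r1" "c r0 \<noteq> c r1"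
    using assms(2) coloured unfolding several_def by metis
  have spread: "spread v w" if "v \<in> V" "w \<in> V" "P v \<and> P w" for v w
    by (rule spread_if_right_alike) (fact alike that)+
  have two: "c v = c r0 \<or> c v = c r1" if v: "v \<in> V" "P v" "\<not> D v" "\<not> E v" for v
  proof (rule ccontr)
    assume "\<not> ?thesis"
    then have neq: "c r0 \<noteq> c v" "c r1 \<noteq> c v"
      by auto
    have C: "C v"
      using v coloured by blast
    show False
      by (rule three_singles[of r0 r1 v]) (fact alike spread r0 r1 v neq C)+
  qed
  obtain r2 where r2: "r2 \<in> V" "\<not> P r2" "\<not> (C r2 \<and> c r2 = c r1)" "\<not> (D r2 \<and> d r2 = d r1)"
    "\<not> (E r2 \<and> e r2 = e r1)"
    by (rule avoid_right)
  interpret Y: cover_system V P c e d C E D s u t n by (rule swap_DE)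
  have alike': "Y.alike v w" if "v \<in> V" "w \<in> V" "\<not> P v \<and> \<not> P w" for v w
    using alike[OF that] by (auto simp: alike_singles_def)
  \<comment> \<open>The edge between \<open>r1\<close> and \<open>r2\<close> can only be covered by
    \<open>r1\<close>, in the first colour. So \<open>c r2 = c r1\<close> differs from
    \<open>c r0\<close>, and the edge between \<open>r0\<close> and \<open>r2\<close> is covered by
    \<open>r2\<close> in another colour.\<close>
  have "D r2 \<and> d r2 = d r0 \<or> E r2 \<and> e r2 = e r0"
    using agree[OF r0(1) r2(1)] agree[OF r1(1) r2(1)] r0 r1 r2 by metis
  then show False
  proof
    assume "D r2 \<and> d r2 = d r0"
    then have *: "D r2" "d r2 = d r0"
      by auto
    show False
      by (rule two_singles_covered[of r0 r1 r2]) (fact alike spread two r0 r1 r2 *)+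
  next
    assume "E r2 \<and> e r2 = e r0"
    then have *: "E r2" "e r2 = e r0"
      by auto
    have two': "c v = c r0 \<or> c v = c r1" if "v \<in> V" "P v" "\<not> E v" "\<not> D v" for v
      using that two by blast
    have spread': "Y.spread v w" if "v \<in> V" "w \<in> V" "P v \<and> P w" for v w
      by (rule Y.spread_if_right_alike) (fact alike' that)+
    show False
      by (rule Y.two_singles_covered[of r0 r1 r2]) (fact alike' spread' two' r0 r1 r2 *)+
  qed
qed

lemma reverse: "cover_system V P e d c E D C u t s n"
  by (rule cover_system.swap_DE[OF cover_system.swap_CD[OF swap_DE]])

lemma misaligned_left:
  assumes alike: "\<And>v w. v \<in> V \<Longrightarrow> w \<in> V \<Longrightarrow> P v = P w \<Longrightarrow> alike v w"
    and v: "v \<in> V" "P v" "\<not> D v" "\<not> E v" and w: "w \<in> V" "\<not> P w" "\<not> C w" "\<not> D w"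
  shows "d v \<noteq> d w"
proof
  assume eq: "d v = d w"
  interpret Y: cover_system V "\<lambda>v. \<not> P v" e d c E D C u t s n
    by (rule cover_system.reverse[OF flip_sides])
  have alike': "Y.alike v w" if "v \<in> V" "w \<in> V" "(\<not> P v) = (\<not> P w)" for v w
    using alike[of v w] that by (auto simp: alike_singles_def)
  have colours: "C v" "E w"
    using v w coloured by auto
  have P: "\<not> \<not> P v" using v by simp
  have "c v = c w \<or> e v = e w"
    using agree[OF v(1) w(1)] v w by blast
  then show False
  proof
    assume *: "c v = c w"
    show False
      by (rule aligned_singles[of v w]) (fact alike v w colours * eq)+
  next
    assume *: "e v = e w"
    show False
      by (rule Y.aligned_singles[of w v]) (fact alike' v w P colours *[symmetric] eq[symmetric])+
  qed
qed

lemma misaligned_CE: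
  assumes alike: "\<And>v w. v \<in> V \<Longrightarrow> w \<in> V \<Longrightarrow> P v = P w \<Longrightarrow> alike v w"
    and v: "v \<in> V" "\<not> D v" "\<not> E v" and w: "w \<in> V" "\<not> C w" "\<not> D w" and sides: "P v \<noteq> P w"
  shows "d v \<noteq> d w"
proof (cases "P v")
  case True
  then have "\<not> P w" using sides by simp
  show ?thesis
    by (rule misaligned_left) (fact alike v w True \<open>\<not> P w\<close>)+
next
  case False
  then have "P w" using sides by simp
  interpret Y: cover_system V P e d c E D C u t s n by (rule reverse)
  have alike': "Y.alike v w" if "v \<in> V" "w \<in> V" "P v = P w" for v w
    using alike[OF that] by (auto simp: alike_singles_def)
  have "d w \<noteq> d v"
    by (rule Y.misaligned_left) (fact alike' v w False \<open>P w\<close>)+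
  then show ?thesis by simp
qed

lemma misaligned_if_alike:
  assumes alike: "\<And>v w. v \<in> V \<Longrightarrow> w \<in> V \<Longrightarrow> P v = P w \<Longrightarrow> alike v w"
    and "v \<in> V" "w \<in> V" "P v \<noteq> P w"
  shows "misaligned v w"
proof -
  interpret X: cover_system V P c e d C E D s u t n by (rule swap_DE)
  interpret Y: cover_system V P d c e D C E t s u n by (rule swap_CD)
  have X: "X.alike v w" and Y: "Y.alike v w" if "v \<in> V" "w \<in> V" "P v = P w" for v w
    using alike[OF that] by (auto simp: alike_singles_def)
  have CE: "d v \<noteq> d w" if "v \<in> V" "w \<in> V" "P v \<noteq> P w" "\<not> D v" "\<not> E v" "\<not> C w" "\<not> D w" for v w
    by (rule misaligned_CE) (fact alike that)+
  have CD: "e v \<noteq> e w" if "v \<in> V" "w \<in> V" "P v \<noteq> P w" "\<not> D v" "\<not> E v" "\<not> C w" "\<not> E w" for v w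
    by (rule X.misaligned_CE) (fact X that)+
  have DE: "c v \<noteq> c w" if "v \<in> V" "w \<in> V" "P v \<noteq> P w" "\<not> C v" "\<not> E v" "\<not> C w" "\<not> D w" for v w
    by (rule Y.misaligned_CE) (fact Y that)+
  show ?thesis
    unfolding misaligned_singles_def
    using assms(2-4) CE[of v w] CE[of w v] CD[of v w] CD[of w v] DE[of v w] DE[of w v] by auto
qed

lemma different_left:
  assumes alike: "\<And>v w. v \<in> V \<Longrightarrow> w \<in> V \<Longrightarrow> P v = P w \<Longrightarrow> alike v w"
    and v: "v \<in> V" "P v" "\<not> D v" "\<not> E v" and w: "w \<in> V" "\<not> P w" "\<not> C w" "\<not> D w"
  shows False
proof -
  interpret Y: cover_system V "\<lambda>v. \<not> P v" e d c E D C u t s n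
    by (rule cover_system.reverse[OF flip_sides])
  have alike': "Y.alike v w" if "v \<in> V" "w \<in> V" "(\<not> P v) = (\<not> P w)" for v w
    using alike[of v w] that by (auto simp: alike_singles_def)
  have mis: "misaligned v w" if "v \<in> V" "w \<in> V" "P v \<noteq> P w" for v w
    by (rule misaligned_if_alike) (fact alike that)+
  have mis': "Y.misaligned v w" if "v \<in> V" "w \<in> V" "(\<not> P v) \<noteq> (\<not> P w)" for v w
    by (rule Y.misaligned_if_alike) (fact alike' that)+
  have colours: "C v" "E w"
    using v w coloured by auto
  have P: "\<not> \<not> P v" using v by simp
  have "c v = c w \<or> e v = e w"
    using agree[OF v(1) w(1)] v w by blast
  then show False
  proof
    assume *: "c v = c w"
    show False
      by (rule different_singles[of v w]) (fact alike mis v w colours *)+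
  next
    assume *: "e v = e w"
    show False
      by (rule Y.different_singles[of w v]) (fact alike' mis' v w P colours *[symmetric])+
  qed
qed

lemma different_CE:
  assumes alike: "\<And>v w. v \<in> V \<Longrightarrow> w \<in> V \<Longrightarrow> P v = P w \<Longrightarrow> alike v w"
    and v: "v \<in> V" "\<not> D v" "\<not> E v" and w: "w \<in> V" "\<not> C w" "\<not> D w" and sides: "P v \<noteq> P w"
  shows False
proof (cases "P v")
  case True
  then have "\<not> P w" using sides by simp
  show ?thesis
    by (rule different_left) (fact alike v w True \<open>\<not> P w\<close>)+
next
  case False
  then have "P w" using sides by simp
  interpret Y: cover_system V P e d c E D C u t s n by (rule reverse)
  have alike': "Y.alike v w" if "v \<in> V" "w \<in> V" "P v = P w" for v w
    using alike[OF that] by (auto simp: alike_singles_def)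
  show ?thesis
    by (rule Y.different_left) (fact alike' v w False \<open>P w\<close>)+
qed

lemma monochrome_if_alike:
  assumes alike: "\<And>v w. v \<in> V \<Longrightarrow> w \<in> V \<Longrightarrow> P v = P w \<Longrightarrow> alike v w"
    and "v \<in> V" "w \<in> V" "P v \<noteq> P w"
  shows "monochrome v w"
proof -
  interpret X: cover_system V P c e d C E D s u t n by (rule swap_DE)
  interpret Y: cover_system V P d c e D C E t s u n by (rule swap_CD)
  have X: "X.alike v w" and Y: "Y.alike v w" if "v \<in> V" "w \<in> V" "P v = P w" for v w
    using alike[OF that] by (auto simp: alike_singles_def)
  have CE: False if "v \<in> V" "w \<in> V" "P v \<noteq> P w" "\<not> D v" "\<not> E v" "\<not> C w" "\<not> D w" for v w
    by (rule different_CE[of v w]) (fact alike that)+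
  have CD: False if "v \<in> V" "w \<in> V" "P v \<noteq> P w" "\<not> D v" "\<not> E v" "\<not> C w" "\<not> E w" for v w
    by (rule X.different_CE[of v w]) (fact X that)+
  have DE: False if "v \<in> V" "w \<in> V" "P v \<noteq> P w" "\<not> C v" "\<not> E v" "\<not> C w" "\<not> D w" for v w
    by (rule Y.different_CE[of v w]) (fact Y that)+
  show ?thesis
    unfolding monochrome_singles_def
    using assms(2-4) CE[of v w] CE[of w v] CD[of v w] CD[of w v] DE[of v w] DE[of w v] by auto
qed

lemma no_left_single:
  assumes alike: "\<And>v w. v \<in> V \<Longrightarrow> w \<in> V \<Longrightarrow> P v = P w \<Longrightarrow> alike v w"
    and v: "v \<in> V" "P v" "C v" "\<not> D v" "\<not> E v"
  shows False
proof -
  have mono: "monochrome v w" if "v \<in> V" "w \<in> V" "P v \<noteq> P w" for v w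
    by (rule monochrome_if_alike) (fact alike that)+
  obtain w where w: "w \<in> V" "\<not> P w" "\<not> (C w \<and> c w = c v)" "\<not> (D w \<and> d w = d v)" "\<not> (E w \<and> e w = e
    v)"
    by (rule avoid_right)
  have eq: "c v = c w" and "\<not> C w"
    using agree[OF v(1) w(1)] v w by auto
  have "D w" "E w"
    using mono[OF v(1) w(1)] v w \<open>\<not> C w\<close> unfolding monochrome_singles_def by auto
  have neq: "d v \<noteq> d w" "e v \<noteq> e w"
    using w \<open>D w\<close> \<open>E w\<close> by auto
  obtain x where x: "x \<in> V" "E w \<longrightarrow> P w \<noteq> P x \<and> e w = e x \<and> \<not> E x
    \<and> \<not> (c w = c x \<and> (C w \<or> C x)) \<and> \<not> (d w = d x \<and> (D w \<or> D x))"
    by (rule witness_E[OF w(1)])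
  have x': "P x" "e w = e x" "\<not> E x" "\<not> (c w = c x \<and> C x)" "d w \<noteq> d x"
    using x w \<open>D w\<close> \<open>E w\<close> \<open>\<not> C w\<close> by auto
  note facts = alike mono v w(1,2) \<open>\<not> C w\<close> \<open>D w\<close> \<open>E w\<close> eq neq x(1) x'
  show False
  proof (cases "d x = d v"; cases "C x")
    assume *: "d x = d v" "C x"
    show False by (rule double_same_C[of v w x]) (fact facts *)+
  next
    assume *: "d x = d v" "\<not> C x"
    show False by (rule double_same_other[of v w x]) (fact facts *)+
  next
    assume *: "d x \<noteq> d v" "C x"
    show False by (rule double_new_C[of v w x]) (fact facts *)+
  next
    assume *: "d x \<noteq> d v" "\<not> C x"
    show False by (rule double_new_other[of v w x]) (fact facts *)+
  qed
qed

lemma double_if_alike: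
  assumes alike: "\<And>v w. v \<in> V \<Longrightarrow> w \<in> V \<Longrightarrow> P v = P w \<Longrightarrow> alike v w"
    and v: "v \<in> V"
  shows "C v \<and> D v \<or> C v \<and> E v \<or> D v \<and> E v"
proof -
  \<comment> \<open>Quantified over the labels and covers because it is applied below with each
    colour in the first place; \<open>H\<close> carries the hypothesis \<open>alike\<close> through
    the renaming.\<close>
  have C: False
    if "cover_system V P c d e C D E s t u n"
      and H: "\<forall>v\<in>V. \<forall>w\<in>V. P v = P w \<longrightarrow> alike_singles c d e C D E v w"
      and single: "C v" "\<not> D v" "\<not> E v"
    for P and c d e :: "'v \<Rightarrow> 'l" and C D E s t u
  proof -
    interpret X: cover_system V P c d e C D E s t u n by fact
    interpret Y: cover_system V "\<lambda>v. \<not> P v" c d e C D E s t u n by (rule X.flip_sides)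
    have a: "X.alike v w" if "v \<in> V" "w \<in> V" "P v = P w" for v w
      using that H by blast
    have b: "X.alike v w" if "v \<in> V" "w \<in> V" "(\<not> P v) = (\<not> P w)" for v w
      using that H by blast
    show False
    proof (cases "P v")
      case True
      show False by (rule X.no_left_single[of v]) (fact a v single True)+
    next
      case False
      show False by (rule Y.no_left_single[of v]) (fact b v single False)+
    qed
  qed
  have swap: "alike_singles d c e D C E v w" "alike_singles e d c E D C v w"
    if "v \<in> V" "w \<in> V" "P v = P w" for v w
    using alike[OF that] by (auto simp: alike_singles_def)
  have 1: "\<forall>v\<in>V. \<forall>w\<in>V. P v = P w \<longrightarrow> alike_singles c d e C D E v w"
    using alike by simp
  have 2: "\<forall>v\<in>V. \<forall>w\<in>V. P v = P w \<longrightarrow> alike_singles d c e D C E v w"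
    and 3: "\<forall>v\<in>V. \<forall>w\<in>V. P v = P w \<longrightarrow> alike_singles e d c E D C v w"
    using swap by simp_all
  have "\<not> (C v \<and> \<not> D v \<and> \<not> E v)" "\<not> (D v \<and> \<not> C v \<and> \<not> E v)" "\<not> (E v \<and> \<not> D v \<and> \<not> C v)"
    using C[OF cover_system_axioms 1] C[OF swap_CD 2] C[OF reverse 3] by auto
  then show ?thesis using coloured[OF v] by auto
qed

lemma not_all_alike:
  assumes alike: "\<And>v w. v \<in> V \<Longrightarrow> w \<in> V \<Longrightarrow> P v = P w \<Longrightarrow> alike v w"
  shows False
proof -
  have double: "C v \<and> D v \<or> C v \<and> E v \<or> D v \<and> E v" if "v \<in> V" for v
    by (rule double_if_alike) (fact alike that)+
  have two: False
    if "cover_system V P c d e C D E s t u n"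
      "\<forall>v\<in>V. C v \<and> D v \<or> C v \<and> E v \<or> D v \<and> E v" "v \<in> V" "C v" "D v" "\<not> E v"
    for P v and c d e :: "'v \<Rightarrow> 'l" and C D E s t u
  proof -
    interpret X: cover_system V P c d e C D E s t u n by fact
    interpret Y: cover_system V "\<lambda>v. \<not> P v" c d e C D E s t u n by (rule X.flip_sides)
    have a: "C v \<and> D v \<or> C v \<and> E v \<or> D v \<and> E v" if "v \<in> V" for v
      using that \<open>\<forall>v\<in>V. C v \<and> D v \<or> C v \<and> E v \<or> D v \<and> E v\<close> by blast
    show False
    proof (cases "P v")
      case True
      show False by (rule X.no_singles[of v]) (fact a that True)+
    next
      case False
      show False by (rule Y.no_singles[of v]) (fact a that False)+
    qed
  qed
  have all: "\<forall>v\<in>V. C v \<and> D v \<or> C v \<and> E v \<or> D v \<and> E v"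
    "\<forall>v\<in>V. C v \<and> E v \<or> C v \<and> D v \<or> E v \<and> D v"
    "\<forall>v\<in>V. E v \<and> D v \<or> E v \<and> C v \<or> D v \<and> C v"
    using double by auto
  have triple: "C v \<and> D v \<and> E v" if "v \<in> V" for v
    using double[OF that] two[OF cover_system_axioms all(1) that]
      two[OF swap_DE all(2) that] two[OF reverse all(3) that] by auto
  obtain v where "v \<in> V"
    by (rule avoid_left)
  \<comment> \<open>A witness for \<open>C\<close> lies outside \<open>C\<close>, so the vertices
    cannot all be covered three times.\<close>
  then show False
    using min_C[of v] triple by blast
qed

lemma not_one_sided:
  assumes alike: "\<And>v w. v \<in> V \<Longrightarrow> w \<in> V \<Longrightarrow> \<not> P v \<and> \<not> P w \<Longrightarrow> alike v w"
    and several: "several V P c D E \<or> several V P d C E \<or> several V P e C D"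
  shows False
proof -
  interpret X: cover_system V P d c e D C E t s u n by (rule swap_CD)
  interpret Y: cover_system V P e c d E C D u s t n by (rule cover_system.swap_CD[OF swap_DE])
  have X: "X.alike v w" and Y: "Y.alike v w" if "v \<in> V" "w \<in> V" "\<not> P v \<and> \<not> P w" for v w
    using alike[OF that] by (auto simp: alike_singles_def)
  from several show False
  proof (elim disjE)
    assume *: "several V P c D E"
    show False by (rule one_sided) (fact alike *)+
  next
    assume *: "several V P d C E"
    show False by (rule X.one_sided) (fact X *)+
  next
    assume *: "several V P e C D"
    show False by (rule Y.one_sided) (fact Y *)+
  qed
qed

lemma alike_if_not_several:
  assumes "\<not> several V q c D E" "\<not> several V q d C E" "\<not> several V q e C D"
    "v \<in> V" "w \<in> V" "q v" "q w"
  shows "alike v w"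
proof -
  have "c v = c w" if "\<not> D v \<and> \<not> E v \<and> \<not> D w \<and> \<not> E w"
    using assms(1,4-7) that unfolding several_def by blast
  moreover have "d v = d w" if "\<not> C v \<and> \<not> E v \<and> \<not> C w \<and> \<not> E w"
    using assms(2,4-7) that unfolding several_def by blast
  moreover have "e v = e w" if "\<not> C v \<and> \<not> D v \<and> \<not> C w \<and> \<not> D w"
    using assms(3-7) that unfolding several_def by blast
  ultimately show ?thesis
    unfolding alike_singles_def by simp
qed

theorem size_bound:
  "n \<le> 2 * s + min t u \<and> n \<le> 2 * (t + u) \<or> n \<le> 2 * t + min s u \<and> n \<le> 2 * (s + u)
    \<or> n \<le> 2 * u + min s t \<and> n \<le> 2 * (s + t)"
proof (rule ccontr)
  assume neg: "\<not> ?thesis"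
  interpret CED: cover_system V P c e d C E D s u t n by (rule swap_DE)
  interpret DCE: cover_system V P d c e D C E t s u n by (rule swap_CD)
  interpret EDC: cover_system V P e d c E D C u t s n by (rule reverse)
  interpret DEC: cover_system V P d e c D E C t u s n by (rule DCE.swap_DE)
  interpret ECD: cover_system V P e c d E C D u s t n by (rule CED.swap_CD)
  have sw: "several V q x X Y = several V q x Y X" for q and x :: "'v \<Rightarrow> 'l" and X Y
    unfolding several_def by blast
  let ?l = "\<lambda>v. P v" and ?r = "\<lambda>v. \<not> P v"
  \<comment> \<open>One right single of the first colour fixes the label of all left singles of that
    colour, since the edges between them can be covered in no other colour.\<close>
  have same: "\<not> (several V P c D E \<and> several V ?r c D E)"
    if "cover_system V P c d e C D E s t u n" for c d e :: "'v \<Rightarrow> 'l" and C D E s t u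
  proof -
    interpret X: cover_system V P c d e C D E s t u n by fact
    have "c v = c w" if "v \<in> V" "w \<in> V" "P v" "\<not> P w" "\<not> D v" "\<not> E v" "\<not> D w" "\<not> E w" for v w
      using X.agree[of v w] that by blast
    then show ?thesis unfolding several_def by metis
  qed
  \<comment> \<open>Each of the six placements of two distinct colours on the two sides yields one
    of the disjuncts denied by \<open>neg\<close>.\<close>
  have mixed: "\<not> (several V P c D E \<and> several V ?r d C E)" "\<not> (several V P c D E \<and> several V ?r e C
    D)"
    "\<not> (several V P d C E \<and> several V ?r c D E)" "\<not> (several V P d C E \<and> several V ?r e C D)"
    "\<not> (several V P e C D \<and> several V ?r c D E)" "\<not> (several V P e C D \<and> several V ?r d C E)"
    using neg mixed CED.mixed DCE.mixed EDC.mixed DEC.mixed ECD.mixed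
    by (auto simp: sw[of _ _ E D] sw[of _ _ E C] sw[of _ _ D C] min.commute add.commute)
  consider (left) "several V P c D E \<or> several V P d C E \<or> several V P e C D"
      "\<not> several V ?r c D E" "\<not> several V ?r d C E" "\<not> several V ?r e C D"
    | (right) "several V ?r c D E \<or> several V ?r d C E \<or> several V ?r e C D"
      "\<not> several V P c D E" "\<not> several V P d C E" "\<not> several V P e C D"
    | (none) "\<not> several V ?r c D E" "\<not> several V ?r d C E" "\<not> several V ?r e C D"
      "\<not> several V P c D E" "\<not> several V P d C E" "\<not> several V P e C D"
    using mixed same[OF cover_system_axioms] same[OF swap_CD] same[OF ECD.cover_system_axioms]
    by blast
  then show False
  proof cases
    case left
    show False
      by (rule not_one_sided[OF _ left(1)]) (rule alike_if_not_several[OF left(2-4)]; blast)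
  next
    case right
    interpret Y: cover_system V ?r c d e C D E s t u n by (rule flip_sides)
    show False
      by (rule Y.not_one_sided[OF _ right(1)]) (rule alike_if_not_several[OF right(2-4)]; blast)
  next
    case none
    show False
    proof (rule not_all_alike)
      fix v w assume "v \<in> V" "w \<in> V" "P v = P w"
      then show "alike v w"
        using alike_if_not_several[OF none(1-3), of v w] alike_if_not_several[OF none(4-6), of v w]
          by blast
    qed
  qed
qed

end

section \<open>From colourings to labelled covers\<close>

definition rel_cover :: "('a \<times> 'b) set \<Rightarrow> 'a set \<Rightarrow> 'b set \<Rightarrow> bool" where
  "rel_cover R X Y \<longleftrightarrow> finite X \<and> finite Y \<and> (\<forall>(a, b)\<in>R. a \<in> X \<or> b \<in> Y)"

lemma rel_cover_converse: "rel_cover (R\<inverse>) Y X \<longleftrightarrow> rel_cover R X Y"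
  unfolding rel_cover_def by auto

text \<open>Neither cover contains \<open>x\<close>, otherwise it would cover \<open>R\<close> with
  fewer than \<open>m\<close> elements; so \<open>y'\<close> is in \<open>Y1\<close> and
  \<open>y\<close> in \<open>Y2\<close>. Then both crossings, with \<open>x\<close> added to
  \<open>X1 \<union> X2\<close>, cover \<open>R\<close>, but their sizes add up to at most
  \<open>(m - 1) + (m - 1) + 1\<close>, less than \<open>2 * m\<close>.\<close>

lemma rel_cover_uncrossing:
  assumes lower: "\<And>X Y. rel_cover R X Y \<Longrightarrow> m \<le> card X + card Y"
    and e: "(x, y) \<in> R" "rel_cover (R - {(x, y)}) X1 Y1" "card X1 + card Y1 < m"
    and f: "(x, y') \<in> R" "rel_cover (R - {(x, y')}) X2 Y2" "card X2 + card Y2 < m"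
    and neq: "y \<noteq> y'"
  shows False
proof -
  have fin: "finite X1" "finite X2" "finite Y1" "finite Y2"
    using e(2) f(2) by (auto simp: rel_cover_def)
  have x1: "x \<notin> X1"
  proof
    assume "x \<in> X1"
    then have "rel_cover R X1 Y1"
      using e(2) by (auto simp: rel_cover_def)
    then show False using lower e(3) by fastforce
  qed
  have x2: "x \<notin> X2"
  proof
    assume "x \<in> X2"
    then have "rel_cover R X2 Y2"
      using f(2) by (auto simp: rel_cover_def)
    then show False using lower f(3) by fastforce
  qed
  have "y' \<in> Y1" "y \<in> Y2"
    using e(1,2) f(1,2) x1 x2 neq by (auto simp: rel_cover_def)
  then have "rel_cover R (X1 \<inter> X2) (Y1 \<union> Y2)" "rel_cover R (insert x (X1 \<union> X2)) (Y1 \<inter> Y2)"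
    using e(2) f(2) by (auto simp: rel_cover_def)
  then have "m \<le> card (X1 \<inter> X2) + card (Y1 \<union> Y2)" "m \<le> card (insert x (X1 \<union> X2)) + card (Y1 \<inter> Y2)"
    using lower by blast+
  moreover have "card (insert x (X1 \<union> X2)) \<le> Suc (card (X1 \<union> X2))"
    using fin by (simp add: card_insert_if)
  ultimately show False
    using card_Un_Int[OF fin(1,2)] card_Un_Int[OF fin(3,4)] e(3) f(3) by linarith
qed

text \<open>Koenig's theorem: an edge-critical bipartite graph is a matching, since the minimum covers
  avoiding two adjacent edges could be uncrossed.\<close>

theorem koenig:
  assumes "finite R"
  shows "\<exists>M X Y. M \<subseteq> R \<and> inj_on fst M \<and> inj_on snd M \<and> rel_cover R X Y \<and> card X + card Y \<le> card M"
  using assms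
proof (induction "card R" arbitrary: R rule: less_induct)
  case less
  have "rel_cover R (fst ` R) {}"
    using less.prems by (auto simp: rel_cover_def rev_image_eqI)
  then obtain X Y where XY: "rel_cover R X Y"
    and least: "\<And>X' Y'. rel_cover R X' Y' \<Longrightarrow> card X + card Y \<le> card X' + card Y'"
    using ex_has_least_nat[of "\<lambda>(X, Y). rel_cover R X Y" "(fst ` R, {})" "\<lambda>(X, Y). card X + card Y"]
    by auto
  show ?case
  proof (cases "\<exists>e\<in>R. \<forall>X' Y'. rel_cover (R - {e}) X' Y' \<longrightarrow> card X + card Y \<le> card X' + card Y'")
    case True
    then obtain e where e: "e \<in> R"
      "\<And>X' Y'. rel_cover (R - {e}) X' Y' \<Longrightarrow> card X + card Y \<le> card X' + card Y'"
      by blast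
    have "card (R - {e}) < card R"
      using less.prems e(1) by (rule card_Diff1_less)
    from less.hyps[OF this] less.prems obtain M X' Y' where
      "M \<subseteq> R - {e}" "inj_on fst M" "inj_on snd M" "rel_cover (R - {e}) X' Y'" "card X' + card Y' \<le>
        card M"
      by auto
    then show ?thesis
      using XY e(2) by (meson Diff_subset order.trans)
  next
    case False
    then have critical: "\<exists>X' Y'. rel_cover (R - {e}) X' Y' \<and> card X' + card Y' < card X + card Y"
      if "e \<in> R" for e
      using that by (meson not_le)
    have "inj_on fst R"
    proof (rule inj_onI, rule ccontr)
      fix p q assume "p \<in> R" "q \<in> R" "fst p = fst q" "p \<noteq> q"
      then obtain x y y' where "p = (x, y)" "q = (x, y')" "(x, y) \<in> R" "(x, y') \<in> R" "y \<noteq> y'"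
        by (metis prod.collapse)
      then show False
        using critical rel_cover_uncrossing[OF least] by metis
    qed
    moreover have "inj_on snd R"
    proof (rule inj_onI, rule ccontr)
      fix p q assume "p \<in> R" "q \<in> R" "snd p = snd q" "p \<noteq> q"
      then obtain x x' y where xy: "(x, y) \<in> R" "(x', y) \<in> R" "x \<noteq> x'"
        by (metis prod.collapse)
      have diff: "R\<inverse> - {(y, z)} = (R - {(z, y)})\<inverse>" for z
        by auto
      from critical[OF xy(1)] critical[OF xy(2)] obtain X1 Y1 X2 Y2 where
        "rel_cover (R\<inverse> - {(y, x)}) Y1 X1" "card Y1 + card X1 < card X + card Y"
        "rel_cover (R\<inverse> - {(y, x')}) Y2 X2" "card Y2 + card X2 < card X + card Y"
        unfolding diff rel_cover_converse by (metis add.commute)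
      moreover have "card X + card Y \<le> card Y' + card X'" if "rel_cover (R\<inverse>) Y' X'" for X' Y'
        using least[of X' Y'] that by (simp add: rel_cover_converse)
      ultimately show False
        using rel_cover_uncrossing[of "R\<inverse>" "card X + card Y" y x Y1 X1 x' Y2 X2] xy by simp
    qed
    moreover have "card (fst ` R) + card ({} :: 'b set) \<le> card R"
      using less.prems by (simp add: card_image_le)
    ultimately show ?thesis
      using \<open>rel_cover R (fst ` R) {}\<close> by blast
  qed
qed

section \<open>Covers of colour classes\<close>

lemma finite_Knn_edges: "finite (Knn_edges n)"
proof -
  have "Knn_edges n = (\<lambda>(i, j). {Inl i, Inr j}) ` ({..<n} \<times> {..<n})"
    unfolding Knn_edges_def by auto
  then show ?thesis by simp
qed

lemma finite_Knn_verts: "finite (Knn_verts n)"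
  unfolding Knn_verts_def by simp

lemma finite_matching_sizes:
  assumes "finite E"
  shows "finite {card M |M. matching E M}" "{card M |M. matching E M} \<noteq> {}"
proof -
  have "{card M |M. matching E M} \<subseteq> card ` Pow E"
    by (auto simp: matching_def)
  then show "finite {card M |M. matching E M}"
    by (rule finite_subset) (simp add: assms)
  have "matching E {}"
    by (simp add: matching_def)
  then show "{card M |M. matching E M} \<noteq> {}" by blast
qed

lemma vertex_cover_of_bipartite:
  assumes sub: "G \<subseteq> Knn_edges n"
  shows "\<exists>S. finite S \<and> card S \<le> matching_number G \<and> (\<forall>e\<in>G. e \<inter> S \<noteq> {})"
proof -
  define R where "R = {(i, j). {Inl i, Inr j} \<in> G}"
  have "R \<subseteq> {..<n} \<times> {..<n}"
    using sub unfolding R_def Knn_edges_def by (auto simp: doubleton_eq_iff)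
  then have "finite R"
    by (rule finite_subset) simp
  from koenig[OF this] obtain M X Y where M: "M \<subseteq> R" "inj_on fst M" "inj_on snd M"
    and cover: "rel_cover R X Y" and card: "card X + card Y \<le> card M"
    by blast
  define edge :: "nat \<times> nat \<Rightarrow> (nat + nat) set" where "edge = (\<lambda>(i, j). {Inl i, Inr j})"
  have "disjoint (edge ` M)"
  proof (rule pairwiseI)
    fix e f assume "e \<in> edge ` M" "f \<in> edge ` M" "e \<noteq> f"
    then obtain p q where pq: "p \<in> M" "q \<in> M" "e = edge p" "f = edge q" "p \<noteq> q" by auto
    then have "fst p \<noteq> fst q" "snd p \<noteq> snd q"
      using M(2,3) by (auto simp: inj_on_def)
    then show "disjnt e f"
      using pq by (auto simp: edge_def disjnt_def split: prod.splits)
  qed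
  moreover have "edge ` M \<subseteq> G"
    using M(1) by (auto simp: edge_def R_def)
  ultimately have "matching G (edge ` M)"
    by (simp add: matching_def)
  moreover have "card (edge ` M) = card M"
    by (rule card_image) (auto simp: inj_on_def edge_def doubleton_eq_iff)
  ultimately have "card M \<in> {card M |M. matching G M}"
    by (metis (mono_tags, lifting) mem_Collect_eq)
  then have "card M \<le> matching_number G"
    unfolding matching_number_def
    by (intro Max_ge finite_matching_sizes(1) finite_subset[OF sub finite_Knn_edges])
  moreover have "card (X <+> Y) = card X + card Y" "finite (X <+> Y)"
    using cover by (auto simp: rel_cover_def card_Plus)
  moreover have "\<forall>e\<in>G. e \<inter> (X <+> Y) \<noteq> {}"
  proof
    fix e assume "e \<in> G"
    with sub obtain i j where "e = {Inl i, Inr j}" "(i, j) \<in> R"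
      unfolding Knn_edges_def R_def by blast
    then show "e \<inter> (X <+> Y) \<noteq> {}"
      using cover unfolding rel_cover_def by auto
  qed
  ultimately show ?thesis
    using card by (intro exI[of _ "X <+> Y"]) simp
qed

lemma colour_class_subset: "colour_class n c x \<subseteq> Knn_edges n"
  unfolding colour_class_def by auto

definition component_of :: "nat \<Rightarrow> (nat + nat) set set \<Rightarrow> nat + nat \<Rightarrow> (nat + nat) set" where
  "component_of n G v = {w \<in> Knn_verts n. (v, w) \<in> (adjacency G)\<^sup>*}"

lemma component_of_in_components:
  assumes "v \<in> Knn_verts n"
  shows "component_of n G v \<in> graph_components (Knn_verts n) G"
  unfolding graph_components_def component_of_def quotient_def using assms by auto

lemma component_of_edge:
  assumes "{v, w} \<in> G"
  shows "component_of n G v = component_of n G w"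
proof -
  have "(v, w) \<in> adjacency G" "(w, v) \<in> adjacency G"
    using assms by (auto simp: adjacency_def insert_commute)
  then show ?thesis
    unfolding component_of_def by (auto intro: converse_rtrancl_into_rtrancl)
qed

lemma edge_in_component:
  assumes "{v, w} \<in> G" "G \<subseteq> Knn_edges n"
  shows "{v, w} \<in> induced_edges G (component_of n G v)"
proof -
  have "v \<in> Knn_verts n" "w \<in> Knn_verts n"
    using assms unfolding Knn_edges_def Knn_verts_def by (auto simp: doubleton_eq_iff)
  moreover have "(v, w) \<in> (adjacency G)\<^sup>*"
    using assms(1) by (auto simp: adjacency_def)
  ultimately show ?thesis
    using assms(1) unfolding induced_edges_def component_of_def by auto
qed

text \<open>The label of a vertex is its component, and Koenig's theorem is applied to each
  component separately, so that at most \<open>k\<close> covering vertices share a label. A set that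
  is not a component is never a label of a vertex of the graph.\<close>

lemma labelled_cover_exists:
  assumes "\<not> has_connected_matching n c x (Suc k)"
  shows "\<exists>lab cov. (\<forall>i. card {v \<in> Knn_verts n. cov v \<and> lab v = i} \<le> k) \<and>
    (\<forall>v w. {v, w} \<in> colour_class n c x \<longrightarrow> lab v = (lab w :: (nat + nat) set) \<and> (cov v \<or> cov w))"
proof -
  define G where "G = colour_class n c x"
  have "\<exists>S. finite S \<and> card S \<le> k \<and> (\<forall>e\<in>induced_edges G K. e \<inter> S \<noteq> {})"
    if "K \<in> graph_components (Knn_verts n) G" for K
  proof -
    have "matching_number (induced_edges G K) \<le> k"
      using assms that unfolding has_connected_matching_def G_def by force
    moreover have "induced_edges G K \<subseteq> Knn_edges n"
      unfolding induced_edges_def G_def colour_class_def by auto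
    ultimately show ?thesis
      using vertex_cover_of_bipartite order.trans by metis
  qed
  then obtain S where S: "\<And>K. K \<in> graph_components (Knn_verts n) G \<Longrightarrow>
      finite (S K) \<and> card (S K) \<le> k \<and> (\<forall>e\<in>induced_edges G K. e \<inter> S K \<noteq> {})"
    by metis
  let ?lab = "component_of n G" and ?cov = "\<lambda>v. v \<in> S (component_of n G v)"
  have "card {v \<in> Knn_verts n. ?cov v \<and> ?lab v = i} \<le> k" for i
  proof (cases "i \<in> graph_components (Knn_verts n) G")
    case True
    then have "card {v \<in> Knn_verts n. ?cov v \<and> ?lab v = i} \<le> card (S i)"
      using S by (intro card_mono) auto
    then show ?thesis using S[OF True] by simp
  next
    case False
    then have "{v \<in> Knn_verts n. ?cov v \<and> ?lab v = i} = {}"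
      using component_of_in_components by blast
    then show ?thesis by (simp only: card.empty)
  qed
  moreover have "?lab v = ?lab w \<and> (?cov v \<or> ?cov w)" if "{v, w} \<in> G" for v w
  proof -
    have "{v, w} \<in> induced_edges G (?lab v)"
      by (rule edge_in_component) (use that colour_class_subset in \<open>auto simp: G_def\<close>)
    moreover have "v \<in> Knn_verts n"
      using that colour_class_subset[of n c x] unfolding G_def Knn_edges_def Knn_verts_def
      by (auto simp: doubleton_eq_iff)
    ultimately have "{v, w} \<inter> S (?lab v) \<noteq> {}"
      using S[OF component_of_in_components] by blast
    then show ?thesis
      using component_of_edge[OF that, of n] by auto
  qed
  ultimately have "\<forall>i. card {v \<in> Knn_verts n. ?cov v \<and> ?lab v = i} \<le> k"
    and "\<forall>v w. {v, w} \<in> colour_class n c x \<longrightarrow> ?lab v = ?lab w \<and> (?cov v \<or> ?cov w)"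
    unfolding G_def by blast+
  then show ?thesis
    by (intro exI conjI)
qed

text \<open>Labels need only be constant along edges, so they may be coarser than components, and
  the components of an explicit colouring never have to be computed. A matching in one component
  picks out distinct covering vertices of one label.\<close>

lemma no_connected_matching_if_labelled_cover:
  assumes cap: "\<And>i. card {v \<in> Knn_verts n. cov v \<and> lab v = i} \<le> k"
    and edge: "\<And>i j. i < n \<Longrightarrow> j < n \<Longrightarrow> c {Inl i, Inr j} = x \<Longrightarrow>
      lab (Inl i) = lab (Inr j) \<and> (cov (Inl i) \<or> cov (Inr j))"
  shows "\<not> has_connected_matching n c x (Suc k)"
proof
  define G where "G = colour_class n c x"
  assume "has_connected_matching n c x (Suc k)"
  then obtain K where K: "K \<in> graph_components (Knn_verts n) G"
    "Suc k \<le> matching_number (induced_edges G K)"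
    unfolding has_connected_matching_def G_def by blast
  have edgeG: "lab v = lab w \<and> (cov v \<or> cov w)" if "{v, w} \<in> G" for v w
  proof -
    from that obtain i j where "{v, w} = {Inl i, Inr j}" "i < n" "j < n" "c {Inl i, Inr j} = x"
      unfolding G_def colour_class_def Knn_edges_def by auto
    then show ?thesis
      using edge[of i j] by (auto simp: doubleton_eq_iff)
  qed
  have same: "lab v = lab w" if "(v, w) \<in> (adjacency G)\<^sup>*" for v w
    using that by induction (use edgeG in \<open>auto simp: adjacency_def\<close>)
  obtain v0 where v0: "K = {w \<in> Knn_verts n. (v0, w) \<in> (adjacency G)\<^sup>*}"
    using K(1) unfolding graph_components_def by (auto elim!: quotientE)
  have "card M \<le> k" if "matching (induced_edges G K) M" for M
  proof -
    have M: "M \<subseteq> induced_edges G K" "disjoint M"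
      using that by (auto simp: matching_def)
    have "\<exists>v\<in>e. v \<in> Knn_verts n \<and> cov v \<and> lab v = lab v0" if "e \<in> M" for e
    proof -
      have e: "e \<in> G" "e \<subseteq> K"
        using that M(1) unfolding induced_edges_def by auto
      then obtain v w where "e = {v, w}"
        unfolding G_def colour_class_def Knn_edges_def by blast
      then show ?thesis
        using e edgeG[of v w] same unfolding v0 by fastforce
    qed
    then obtain f where f: "\<And>e. e \<in> M \<Longrightarrow> f e \<in> e \<and> f e \<in> Knn_verts n \<and> cov (f e) \<and> lab (f e) = lab
      v0"
      by metis
    have "inj_on f M"
      using f M(2) by (intro inj_onI) (metis disjnt_iff pairwiseD)
    then have "card M = card (f ` M)"
      by (simp add: card_image)
    also have "\<dots> \<le> card {v \<in> Knn_verts n. cov v \<and> lab v = lab v0}"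
      using f finite_Knn_verts by (intro card_mono) auto
    finally show ?thesis
      using cap order.trans by blast
  qed
  moreover have "finite (induced_edges G K)"
    unfolding induced_edges_def G_def
    by (rule finite_subset[OF _ finite_Knn_edges[of n]]) (auto simp: colour_class_def)
  ultimately have "matching_number (induced_edges G K) \<le> k"
    unfolding matching_number_def by (intro Max.boundedI finite_matching_sizes) auto
  then show False using K(2) by simp
qed

text \<open>The labels stay fixed and the total size of the three covers is minimised. Removing
  \<open>v\<close> from a cover preserves the size bounds and therefore uncovers an edge; this edge
  contains \<open>v\<close>, and its other end is the required \<open>w\<close>.\<close>

lemma minimal_cover_system:
  fixes c d e :: "'v \<Rightarrow> 'l"
  assumes V: "finite V" and n: "card {v \<in> V. P v} = n" "card {v \<in> V. \<not> P v} = n" and large: "s + t +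
    u < n"
    and agree: "\<And>v w. v \<in> V \<Longrightarrow> w \<in> V \<Longrightarrow> P v \<noteq> P w \<Longrightarrow>
      c v = c w \<and> (C v \<or> C w) \<or> d v = d w \<and> (D v \<or> D w) \<or> e v = e w \<and> (E v \<or> E w)"
    and cap: "\<And>i. card {v \<in> V. C v \<and> c v = i} \<le> s" "\<And>i. card {v \<in> V. D v \<and> d v = i} \<le> t"
      "\<And>i. card {v \<in> V. E v \<and> e v = i} \<le> u"
  shows "\<exists>C D E. cover_system V P c d e C D E s t u n"
proof -
  define good where "good = (\<lambda>(C, D, E). (\<forall>v\<in>V. \<forall>w\<in>V. P v \<noteq> P w \<longrightarrow>
      c v = c w \<and> (C v \<or> C w) \<or> d v = d w \<and> (D v \<or> D w) \<or> e v = e w \<and> (E v \<or> E w))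
    \<and> (\<forall>i. card {v \<in> V. C v \<and> c v = i} \<le> s) \<and> (\<forall>i. card {v \<in> V. D v \<and> d v = i} \<le> t)
    \<and> (\<forall>i. card {v \<in> V. E v \<and> e v = i} \<le> u))"
  define size where "size = (\<lambda>(C, D, E). card {v \<in> V. C v} + card {v \<in> V. D v} + card {v \<in> V. E v})"
  have "good (C, D, E)"
    using agree cap by (auto simp: good_def)
  then obtain C D E where good: "good (C, D, E)"
    and least: "\<And>C' D' E'. good (C', D', E') \<Longrightarrow> size (C, D, E) \<le> size (C', D', E')"
    using ex_has_least_nat[of good "(C, D, E)" size] by (metis prod_cases3)
  have smaller: "card {w \<in> V. (X(v := False)) w} < card {w \<in> V. X w}" if "v \<in> V" "X v" for X and v
    :: 'v
    using that V by (intro psubset_card_mono) auto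
  have cap': "card {w \<in> V. (X(v := False)) w \<and> x w = i} \<le> k"
    if "\<And>i. card {v \<in> V. X v \<and> x v = i} \<le> k" for X v and x :: "'v \<Rightarrow> 'l" and i k
    by (rule order.trans[OF card_mono that[of i]]) (use V in auto)
  have fails: "\<not> good (C(v := False), D, E)" if "v \<in> V" "C v" for v
    using least[of "C(v := False)" D E] smaller[of v C, OF that] by (auto simp: size_def)
  have fails': "\<not> good (C, D(v := False), E)" if "v \<in> V" "D v" for v
    using least[of C "D(v := False)" E] smaller[of v D, OF that] by (auto simp: size_def)
  have fails'': "\<not> good (C, D, E(v := False))" if "v \<in> V" "E v" for v
    using least[of C D "E(v := False)"] smaller[of v E, OF that] by (auto simp: size_def)
  have agree: "c v = c w \<and> (C v \<or> C w) \<or> d v = d w \<and> (D v \<or> D w) \<or> e v = e w \<and> (E v \<or> E w)"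
    if "v \<in> V" "w \<in> V" "P v \<noteq> P w" for v w
    using good that by (auto simp: good_def)
  have caps: "card {v \<in> V. C v \<and> c v = i} \<le> s" "card {v \<in> V. D v \<and> d v = i} \<le> t"
    "card {v \<in> V. E v \<and> e v = i} \<le> u" for i
    using good by (auto simp: good_def)
  have "cover_system V P c d e C D E s t u n"
  proof
    fix v assume v: "v \<in> V"
    show "\<exists>w\<in>V. P v \<noteq> P w \<and> c v = c w \<and> \<not> C w
        \<and> \<not> (d v = d w \<and> (D v \<or> D w)) \<and> \<not> (e v = e w \<and> (E v \<or> E w))" if "C v"
    proof -
      from fails[OF v that] obtain x y where "x \<in> V" "y \<in> V" "P x \<noteq> P y" and
        *: "\<not> (c x = c y \<and> ((C(v := False)) x \<or> (C(v := False)) y))"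
        "\<not> (d x = d y \<and> (D x \<or> D y))" "\<not> (e x = e y \<and> (E x \<or> E y))"
        using caps cap'[OF caps(1)] unfolding good_def by (auto simp del: fun_upd_apply)
      moreover from this have "c x = c y" "C x \<or> C y"
        using agree[of x y] by auto
      ultimately show ?thesis
        by (cases "x = v"; cases "y = v") (force split: if_splits)+
    qed
    show "\<exists>w\<in>V. P v \<noteq> P w \<and> d v = d w \<and> \<not> D w
        \<and> \<not> (c v = c w \<and> (C v \<or> C w)) \<and> \<not> (e v = e w \<and> (E v \<or> E w))" if "D v"
    proof -
      from fails'[OF v that] obtain x y where "x \<in> V" "y \<in> V" "P x \<noteq> P y" and
        *: "\<not> (d x = d y \<and> ((D(v := False)) x \<or> (D(v := False)) y))"
        "\<not> (c x = c y \<and> (C x \<or> C y))" "\<not> (e x = e y \<and> (E x \<or> E y))"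
        using caps cap'[OF caps(2)] unfolding good_def by (auto simp del: fun_upd_apply)
      moreover from this have "d x = d y" "D x \<or> D y"
        using agree[of x y] by auto
      ultimately show ?thesis
        by (cases "x = v"; cases "y = v") (force split: if_splits)+
    qed
    show "\<exists>w\<in>V. P v \<noteq> P w \<and> e v = e w \<and> \<not> E w
        \<and> \<not> (c v = c w \<and> (C v \<or> C w)) \<and> \<not> (d v = d w \<and> (D v \<or> D w))" if "E v"
    proof -
      from fails''[OF v that] obtain x y where "x \<in> V" "y \<in> V" "P x \<noteq> P y" and
        *: "\<not> (e x = e y \<and> ((E(v := False)) x \<or> (E(v := False)) y))"
        "\<not> (c x = c y \<and> (C x \<or> C y))" "\<not> (d x = d y \<and> (D x \<or> D y))"
        using caps cap'[OF caps(3)] unfolding good_def by (auto simp del: fun_upd_apply)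
      moreover from this have "e x = e y" "E x \<or> E y"
        using agree[of x y] by auto
      ultimately show ?thesis
        by (cases "x = v"; cases "y = v") (force split: if_splits)+
    qed
  qed (use V n large agree caps in auto)
  then show ?thesis by blast
qed

lemma card_sides:
  "card {v \<in> Knn_verts n. isl v} = n" "card {v \<in> Knn_verts n. \<not> isl v} = n"
proof -
  have "{v \<in> Knn_verts n. isl v} = Inl ` {..<n}" "{v \<in> Knn_verts n. \<not> isl v} = Inr ` {..<n}"
    unfolding Knn_verts_def by auto
  then show "card {v \<in> Knn_verts n. isl v} = n" "card {v \<in> Knn_verts n. \<not> isl v} = n"
    by (simp_all add: card_image)
qed

lemma not_forced_bound:
  assumes "\<not> forces_connected_matching (Suc s) (Suc t) (Suc u) n" "s \<le> t" "t \<le> u" "s + t + u < n"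
  shows "n \<le> s + 2 * u \<and> n \<le> 2 * s + 2 * t"
proof -
  from assms(1) obtain f :: "(nat + nat) set \<Rightarrow> colour" where f:
    "\<not> has_connected_matching n f Red (Suc s)" "\<not> has_connected_matching n f Blue (Suc t)"
    "\<not> has_connected_matching n f Green (Suc u)"
    unfolding forces_connected_matching_def by blast
  from labelled_cover_exists[OF f(1)] obtain c :: "nat + nat \<Rightarrow> (nat + nat) set" and C where
    C: "\<And>i. card {v \<in> Knn_verts n. C v \<and> c v = i} \<le> s"
      "\<And>v w. {v, w} \<in> colour_class n f Red \<Longrightarrow> c v = c w \<and> (C v \<or> C w)"
    by blast
  from labelled_cover_exists[OF f(2)] obtain d :: "nat + nat \<Rightarrow> (nat + nat) set" and D where
    D: "\<And>i. card {v \<in> Knn_verts n. D v \<and> d v = i} \<le> t"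
      "\<And>v w. {v, w} \<in> colour_class n f Blue \<Longrightarrow> d v = d w \<and> (D v \<or> D w)"
    by blast
  from labelled_cover_exists[OF f(3)] obtain e :: "nat + nat \<Rightarrow> (nat + nat) set" and E where
    E: "\<And>i. card {v \<in> Knn_verts n. E v \<and> e v = i} \<le> u"
      "\<And>v w. {v, w} \<in> colour_class n f Green \<Longrightarrow> e v = e w \<and> (E v \<or> E w)"
    by blast
  have "c v = c w \<and> (C v \<or> C w) \<or> d v = d w \<and> (D v \<or> D w) \<or> e v = e w \<and> (E v \<or> E w)"
    if "v \<in> Knn_verts n" "w \<in> Knn_verts n" "isl v \<noteq> isl w" for v w
  proof -
    have "{v, w} \<in> Knn_edges n"
      using that unfolding Knn_verts_def Knn_edges_def by (auto simp: insert_commute)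
    then show ?thesis
      using C(2)[of v w] D(2)[of v w] E(2)[of v w] unfolding colour_class_def
      by (cases "f {v, w}") auto
  qed
  from minimal_cover_system[where P = isl, OF finite_Knn_verts card_sides assms(4) this C(1) D(1)
    E(1)]
  obtain C D E where "cover_system (Knn_verts n) isl c d e C D E s t u n"
    by blast
  \<comment> \<open>For \<open>s \<le> t \<le> u\<close> neither \<open>2 * s + min t u\<close> nor
    \<open>2 * t + min s u\<close> exceeds \<open>s + t + u\<close>, so only the disjunct with
    \<open>2 * u\<close> remains.\<close>
  then show ?thesis
    using cover_system.size_bound assms(2-4) by fastforce
qed

section \<open>Extremal colourings\<close>

lemma card_index_le:
  assumes "\<And>i. i < n \<Longrightarrow> q (Inl i) \<Longrightarrow> a \<le> i \<and> i < b" "\<And>j. j < n \<Longrightarrow> q (Inr j) \<Longrightarrow> a' \<le> j \<and> j < b'"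
    and "b - a + (b' - a') \<le> k"
  shows "card {v \<in> Knn_verts n. q v} \<le> k"
proof -
  have "card {v \<in> Knn_verts n. q v} \<le> card (Inl ` {a..<b} \<union> Inr ` {a'..<b'} :: (nat + nat) set)"
    using assms(1,2) by (intro card_mono) (auto simp: Knn_verts_def)
  also have "\<dots> \<le> (b - a) + (b' - a')"
    by (rule order.trans[OF card_Un_le]) (simp add: card_image)
  finally show ?thesis using assms(3) by simp
qed

lemma colouring_exists:
  fixes g :: "nat \<Rightarrow> nat \<Rightarrow> colour"
  shows "\<exists>f :: (nat + nat) set \<Rightarrow> colour. \<forall>i j. f {Inl i, Inr j} = g i j"
  by (intro exI[of _ "\<lambda>e. g (THE i. Inl i \<in> e) (THE j. Inr j \<in> e)"] allI) simp

text \<open>The colour depends on the left end only, and at most \<open>s\<close>, \<open>t\<close>,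
  \<open>u\<close> left vertices carry the three colours. Each of these sets covers its whole colour
  class, so a single label, of unit type, is enough.\<close>

lemma not_forced_split:
  assumes "n \<le> s + t + u"
  shows "\<not> forces_connected_matching (Suc s) (Suc t) (Suc u) n"
proof -
  obtain f :: "(nat + nat) set \<Rightarrow> colour" where
    f: "f {Inl i, Inr j} = (if i < s then Red else if i < s + t then Blue else Green)" for i j
    using colouring_exists[of "\<lambda>i j. if i < s then Red else if i < s + t then Blue else Green"] by
      blast
  have "\<not> has_connected_matching n f Red (Suc s)"
  proof (rule no_connected_matching_if_labelled_cover)
    show "card {v \<in> Knn_verts n. v \<in> Inl ` {0..<s} \<and> () = i} \<le> s" for i
      by (rule card_index_le[where a = 0 and b = s and a' = 0 and b' = 0]) auto
  qed (auto simp: f split: if_splits)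
  moreover have "\<not> has_connected_matching n f Blue (Suc t)"
  proof (rule no_connected_matching_if_labelled_cover)
    show "card {v \<in> Knn_verts n. v \<in> Inl ` {s..<s + t} \<and> () = i} \<le> t" for i
      by (rule card_index_le[where a = s and b = "s + t" and a' = 0 and b' = 0]) auto
  qed (auto simp: f split: if_splits)
  moreover have "\<not> has_connected_matching n f Green (Suc u)"
  proof (rule no_connected_matching_if_labelled_cover)
    show "card {v \<in> Knn_verts n. v \<in> Inl ` {s + t..<n} \<and> () = i} \<le> u" for i
      by (rule card_index_le[where a = "s + t" and b = n and a' = 0 and b' = 0]) (use assms in auto)
  qed (auto simp: f split: if_splits)
  ultimately show ?thesis
    unfolding forces_connected_matching_def by blast
qed

text \<open>The left side is cut into blocks of sizes \<open>s\<close>, \<open>s\<close>, \<open>t\<close> and at most \<open>t\<close>, the right side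
  into blocks of sizes \<open>s\<close>, \<open>u\<close> and at most \<open>u\<close>; every colour then has two or three components.\<close>

lemma not_forced_blocks:
  assumes "s \<le> t" "n \<le> s + 2 * u" "n \<le> 2 * s + 2 * t"
  shows "\<not> forces_connected_matching (Suc s) (Suc t) (Suc u) n"
proof -
  \<comment> \<open>Every colour class splits into pieces covered by a single block each. In red
    these blocks are the first right one and the two left ones of size \<open>s\<close>; in blue the
    first right one, which fits as \<open>s \<le> t\<close>, and the other two left ones; in green
    the last two right ones. The labels below distinguish the pieces.\<close>
  define g where "g i j =
    (if j < s then if i < 2 * s then Blue else Red
     else if j < s + u then
       if i < s then Green else if i < 2 * s then Red else if i < 2 * s + t then Green else Blue
     else if i < s then Red else if i < 2 * s then Green else if i < 2 * s + t then Blue else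
       Green)"
    for i j
  obtain f :: "(nat + nat) set \<Rightarrow> colour" where f: "f {Inl i, Inr j} = g i j" for i j
    using colouring_exists[of g] by blast
  have "\<not> has_connected_matching n f Red (Suc s)"
  proof (rule no_connected_matching_if_labelled_cover)
    let ?lab = "case_sum (\<lambda>i. if i < s then 2 else if i < 2 * s then 1 else 0)
        (\<lambda>j. if j < s then 0 else if j < s + u then 1 else 2) :: nat + nat \<Rightarrow> nat"
    let ?cov = "case_sum (\<lambda>i. i < 2 * s) (\<lambda>j. j < s)"
    show "card {v \<in> Knn_verts n. ?cov v \<and> ?lab v = i} \<le> s" for i
    proof -
      consider "i = 0" | "i = 1" | "i \<noteq> 0" "i \<noteq> 1"
        by blast
      then show ?thesis
      proof cases
        case 1
        show ?thesis
          by (rule card_index_le[where a = 0 and b = 0 and a' = 0 and b' = s])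
            (simp_all only: sum.case 1 split: if_split_asm, simp_all)
      next
        case 2
        show ?thesis
          by (rule card_index_le[where a = s and b = "2 * s" and a' = 0 and b' = 0])
            (simp_all only: sum.case 2 split: if_split_asm, simp_all)
      next
        case 3
        show ?thesis
          by (rule card_index_le[where a = 0 and b = s and a' = 0 and b' = 0])
            (simp_all only: sum.case split: if_split_asm, (use 3 in \<open>auto\<close>)+)
      qed
    qed
  qed (simp only: f g_def sum.case split: if_split_asm; simp)
  moreover have "\<not> has_connected_matching n f Blue (Suc t)"
  proof (rule no_connected_matching_if_labelled_cover)
    let ?lab = "case_sum (\<lambda>i. if i < 2 * s then 1 else if i < 2 * s + t then 2 else 0)
        (\<lambda>j. if j < s then 1 else if j < s + u then 0 else 2) :: nat + nat \<Rightarrow> nat"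
    let ?cov = "case_sum (\<lambda>i. 2 * s \<le> i) (\<lambda>j. j < s)"
    show "card {v \<in> Knn_verts n. ?cov v \<and> ?lab v = i} \<le> t" for i
    proof -
      consider "i = 1" | "i = 2" | "i \<noteq> 1" "i \<noteq> 2"
        by blast
      then show ?thesis
      proof cases
        case 1
        show ?thesis
          by (rule card_index_le[where a = 0 and b = 0 and a' = 0 and b' = s])
            (simp_all only: sum.case 1 split: if_split_asm, simp_all add: \<open>s \<le> t\<close>)
      next
        case 2
        show ?thesis
          by (rule card_index_le[where a = "2 * s" and b = "2 * s + t" and a' = 0 and b' = 0])
            (simp_all only: sum.case 2 split: if_split_asm, simp_all)
      next
        case 3
        \<comment> \<open>The last left block takes whatever remains, possibly nothing; this is the
          origin of the bound \<open>2 * s + 2 * t\<close>, as the last right block is of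
          \<open>s + 2 * u\<close>.\<close>
        have "n - (2 * s + t) \<le> t"
          using assms by simp
        then show ?thesis
          by (intro card_index_le[where a = "2 * s + t" and b = n and a' = 0 and b' = 0])
            (simp_all only: sum.case split: if_split_asm, (use 3 in \<open>auto\<close>)+)
      qed
    qed
  qed (simp only: f g_def sum.case split: if_split_asm; simp)
  moreover have "\<not> has_connected_matching n f Green (Suc u)"
  proof (rule no_connected_matching_if_labelled_cover)
    let ?lab = "case_sum (\<lambda>i. i < s \<or> 2 * s \<le> i \<and> i < 2 * s + t) (\<lambda>j. j < s + u) :: nat + nat \<Rightarrow>
      bool"
    let ?cov = "case_sum (\<lambda>_. False) (\<lambda>j. s \<le> j) :: nat + nat \<Rightarrow> bool"
    show "card {v \<in> Knn_verts n. ?cov v \<and> ?lab v = i} \<le> u" for i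
    proof (cases i)
      case True
      show ?thesis
        by (rule card_index_le[where a = 0 and b = 0 and a' = s and b' = "s + u"]) (simp_all add:
          True)
    next
      case False
      have "n - (s + u) \<le> u"
        using assms by simp
      then show ?thesis
        by (intro card_index_le[where a = 0 and b = 0 and a' = "s + u" and b' = n]) (simp_all add:
          False)
    qed
  qed (simp only: f g_def sum.case split: if_split_asm; simp)
  ultimately show ?thesis
    unfolding forces_connected_matching_def by blast
qed

section \<open>The exact threshold\<close>

lemma forces_iff:
  assumes "s \<le> t" "t \<le> u"
  shows "forces_connected_matching (Suc s) (Suc t) (Suc u) n \<longleftrightarrow>
    s + t + u < n \<and> (s + 2 * u < n \<or> 2 * s + 2 * t < n)"
  using not_forced_bound[OF _ assms, of n] not_forced_split[of n s t u]
    not_forced_blocks[of s t n u] assms(1) by (meson not_le)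

text \<open>The sizes that force nothing form an initial segment whose last element is the maximum
  on the right, hence the successor.\<close>

lemma connected_ramsey_eq:
  assumes "s \<le> t" "t \<le> u"
  shows "connected_ramsey (Suc s) (Suc t) (Suc u)
    = Suc (max (s + t + u) (min (s + 2 * u) (2 * s + 2 * t)))"
  unfolding connected_ramsey_def forces_iff[OF assms] by (rule Least_equality) auto

theorem theorem1p2:
  fixes k l m :: nat
  assumes "2 \<le> k" and "k < l" and "l < m"
  shows "(3 \<le> k \<and> k < l \<and> l < m \<and> real m \<le> real l + (real k - 1) / 2
            \<longrightarrow> connected_ramsey k l m = k + 2 * m - 2) \<and>
         (3 \<le> k \<and> k < l \<and> real l + (real k - 1) / 2 < real m \<and> m < k + l - 1
            \<longrightarrow> connected_ramsey k l m = 2 * k + 2 * l - 3) \<and>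
         (2 \<le> k \<and> k < l \<and> k + l - 1 \<le> m
            \<longrightarrow> connected_ramsey k l m = k + l + m - 2)"
proof -
  obtain s t u where klm: "k = Suc s" "l = Suc t" "m = Suc u"
    using assms by (cases k; cases l; cases m) auto
  \<comment> \<open>In terms of \<open>s\<close>, \<open>t\<close>, \<open>u\<close> the condition
    reads \<open>s + 2 * u \<le> 2 * s + 2 * t\<close>, which decides where the minimum is attained.
    The other boundary, \<open>u = s + t\<close>, is where \<open>2 * s + 2 * t\<close> equals
    \<open>s + t + u\<close>.\<close>
  have middle: "real m \<le> real l + (real k - 1) / 2 \<longleftrightarrow> 2 * u \<le> 2 * t + s"
    unfolding klm by (simp add: field_simps) linarith
  have order: "s < t" "t < u"
    using assms klm by auto
  have ramsey: "connected_ramsey k l m = Suc (max (s + t + u) (min (s + 2 * u) (2 * s + 2 * t)))"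
    unfolding klm by (rule connected_ramsey_eq) (use order in simp_all)
  show ?thesis
  proof (intro conjI impI; elim conjE)
    assume "real m \<le> real l + (real k - 1) / 2"
    then have "2 * u \<le> 2 * t + s"
      using middle by blast
    then show "connected_ramsey k l m = k + 2 * m - 2"
      unfolding ramsey using order klm by (simp add: max_def min_def)
  next
    assume "real l + (real k - 1) / 2 < real m" "m < k + l - 1"
    then have "2 * t + s < 2 * u" "u \<le> s + t"
      using middle klm by linarith+
    then show "connected_ramsey k l m = 2 * k + 2 * l - 3"
      unfolding ramsey using order klm by (simp add: max_def min_def)
  next
    assume "k + l - 1 \<le> m"
    then have "s + t \<le> u"
      using klm by simp
    then show "connected_ramsey k l m = k + l + m - 2"
      unfolding ramsey using order klm by (simp add: max_def min_def)
  qed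
qed

end
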